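(* If $K$ is a compact metric space, then $C(K)$ has the Bishop-Phelps-Bollobás (BPB) property for numerical radius.
   Context: $C(K)$ is the real Banach space of continuous real-valued functions on $K$ with the supremum norm. For a real Banach space $X$, $\mathfrak{L}(X)$ is the space of bounded linear operators $X\to X$, $\Pi(X)=\{(x,x^* )\in S_X\times S_{X^*}\colon x^*(x)=1\}$ (where $S$ denotes unit spheres), and the numerical radius of $T\in\mathfrak{L}(X)$ is $\nu(T)=\sup\{|x^*(T(x))|\colon (x,x^* )\in\Pi(X)\}$. $X$ has the BPB property for numerical radius if there is a function $\delta\colon(0,1)\to(0,1)$ such that: for every $0<\varepsilon<1$, every $T\in\mathfrak{L}(X)$ with $\nu(T)=1$ and every $(x,x^* )\in\Pi(X)$ with $x^*(T(x))\ge 1-\delta(\varepsilon)$, there exist $T_0\in\mathfrak{L}(X)$ with $\nu(T_0)=1$ and $(x_0,x_0^* )\in\Pi(X)$ with $x_0^*(T_0(x_0))=1$ such that $\nu(T-T_0)\le\varepsilon$, $\|x-x_0\|\le\varepsilon$ and $\|x^*-x_0^*\|\le\varepsilon$. *)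

theory Defs
  imports "HOL-Analysis.Analysis"
begin

instance bcontfun :: (metric_space, banach) banach ..

definition state_pairs :: "('x::banach \<times> ('x \<Rightarrow>\<^sub>L real)) set" where
  "state_pairs = {(x, f). norm x = 1 \<and> norm f = 1 \<and> blinfun_apply f x = 1}"

text \<open>The set below is bounded above by \<open>norm T\<close>, and it is nonempty unless the space is
  zero; on the zero space the real supremum is that of the empty set and hence unspecified.
  This is harmless for \<open>BPB_numerical_radius\<close>, which then quantifies over an empty
  \<open>state_pairs\<close>.\<close>
definition numerical_radius :: "('x::banach \<Rightarrow>\<^sub>L 'x) \<Rightarrow> real" where
  "numerical_radius T =
     Sup {\<bar>blinfun_apply f (blinfun_apply T x)\<bar> | x f. (x, f) \<in> state_pairs}"

definition BPB_numerical_radius :: "'x::banach itself \<Rightarrow> bool" where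
  "BPB_numerical_radius (_ :: 'x itself) \<longleftrightarrow>
     (\<exists>\<delta> :: real \<Rightarrow> real.
        (\<forall>\<epsilon>\<in>{0<..<1}. \<delta> \<epsilon> \<in> {0<..<1}) \<and>
        (\<forall>\<epsilon>\<in>{0<..<1}. \<forall>(T :: 'x \<Rightarrow>\<^sub>L 'x) (x :: 'x) (f :: 'x \<Rightarrow>\<^sub>L real).
           numerical_radius T = 1 \<longrightarrow> (x, f) \<in> state_pairs \<longrightarrow>
           blinfun_apply f (blinfun_apply T x) \<ge> 1 - \<delta> \<epsilon> \<longrightarrow>
           (\<exists>(T\<^sub>0 :: 'x \<Rightarrow>\<^sub>L 'x) (x\<^sub>0 :: 'x) (f\<^sub>0 :: 'x \<Rightarrow>\<^sub>L real).
              numerical_radius T\<^sub>0 = 1 \<and> (x\<^sub>0, f\<^sub>0) \<in> state_pairs \<and>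
              blinfun_apply f\<^sub>0 (blinfun_apply T\<^sub>0 x\<^sub>0) = 1 \<and>
              numerical_radius (T - T\<^sub>0) \<le> \<epsilon> \<and>
              norm (x - x\<^sub>0) \<le> \<epsilon> \<and> norm (f - f\<^sub>0) \<le> \<epsilon>)))"

end

theory Submission
  imports Defs
begin

text \<open>
  No integral representation is needed. If \<open>(x, f)\<close> is a state pair, then \<open>u \<mapsto> f (x * u)\<close>
  is a positive functional that vanishes on multiples of \<open>1 - x\<^sup>2\<close>, so \<open>f\<close> can be cut down to the
  region where \<open>x * T x\<close> is close to 1 with a small loss of norm. On that region
  \<open>u \<mapsto> x * T (x * u)\<close> almost preserves the unit, and the heart of the proof is that an operator of
  norm at most 1 is close to a positive unital operator wherever it almost preserves the unit.

  To see this, decompose the unit by finer and finer partitions of unity, which form a tree. The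
  operator assigns to each node of the tree a signed mass, additive along the tree. Going down the
  tree, split the unit mass at the root into nonnegative masses that imitate the signed ones; this
  can be done continuously, with total error controlled by the increase of total variation. The
  nonnegative masses, placed at points of the supports, converge weakly to the positive operator.
  Conjugating back by a modification of \<open>x\<close> and gluing with \<open>T\<close> outside the region gives \<open>T\<^sub>0\<close>.
\<close>

section \<open>The Banach algebra of bounded continuous functions\<close>

instantiation bcontfun :: (topological_space, real_normed_algebra_1) real_normed_algebra_1
begin

definition one_bcontfun :: "'a \<Rightarrow>\<^sub>C 'b" where
  "one_bcontfun = const_bcontfun 1"

definition times_bcontfun :: "('a \<Rightarrow>\<^sub>C 'b) \<Rightarrow> ('a \<Rightarrow>\<^sub>C 'b) \<Rightarrow> ('a \<Rightarrow>\<^sub>C 'b)" where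
  "times_bcontfun f g = Bcontfun (\<lambda>t. f t * g t)"

lemma apply_one_bcontfun [simp]: "apply_bcontfun (1 :: 'a \<Rightarrow>\<^sub>C 'b) = (\<lambda>_. 1)"
  by (simp add: one_bcontfun_def fun_eq_iff)

lemma apply_times_bcontfun [simp]:
  "apply_bcontfun (f * g :: 'a \<Rightarrow>\<^sub>C 'b) = (\<lambda>t. apply_bcontfun f t * apply_bcontfun g t)"
proof -
  have "norm (f t * g t) \<le> norm f * norm g" for t
    by (rule order_trans[OF norm_mult_ineq]) (intro mult_mono norm_bounded norm_ge_zero)
  then have "(\<lambda>t. f t * g t) \<in> bcontfun"
    by (intro bcontfun_normI) (auto intro!: continuous_intros)
  then show ?thesis
    by (simp add: times_bcontfun_def Bcontfun_inverse)
qed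

instance
proof
  show "norm (1 :: 'a \<Rightarrow>\<^sub>C 'b) = 1"
  proof (rule antisym)
    show "norm (1 :: 'a \<Rightarrow>\<^sub>C 'b) \<le> 1" by (rule norm_bound) simp
    show "1 \<le> norm (1 :: 'a \<Rightarrow>\<^sub>C 'b)"
      using norm_bounded[of "1 :: 'a \<Rightarrow>\<^sub>C 'b"] by simp
  qed
  show "(0 :: 'a \<Rightarrow>\<^sub>C 'b) \<noteq> 1"
    by (metis apply_one_bcontfun zero_bcontfun.rep_eq zero_neq_one)
  show "norm (f * g) \<le> norm f * norm g" for f g :: "'a \<Rightarrow>\<^sub>C 'b"
    by (rule norm_bound, simp, rule order_trans[OF norm_mult_ineq])
      (intro mult_mono norm_bounded norm_ge_zero)
qed (auto intro!: bcontfun_eqI simp: algebra_simps)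

end

lemma sum_bcontfun_apply:
  "apply_bcontfun (\<Sum>i\<in>I. f i) t = (\<Sum>i\<in>I. apply_bcontfun (f i) t)"
  by (induction I rule: infinite_finite_induct) auto

lemma bcontfun_of_continuous:
  fixes f :: "'k::metric_space \<Rightarrow> 'b::metric_space"
  assumes "compact (UNIV :: 'k set)" "continuous_on UNIV f"
  shows "apply_bcontfun (Bcontfun f) = f"
  using assms compact_continuous_image compact_imp_bounded
  by (intro Bcontfun_inverse) (fastforce simp: bcontfun_def)

lemma abs_bcontfun_le_norm: "\<bar>apply_bcontfun f t\<bar> \<le> norm f" for f :: "'k::topological_space \<Rightarrow>\<^sub>C real"
  using norm_bounded[of f t] by simp

lemma norm_bcontfun_le: "(\<And>t. \<bar>apply_bcontfun f t\<bar> \<le> b) \<Longrightarrow> norm f \<le> b"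
  for f :: "'k::topological_space \<Rightarrow>\<^sub>C real"
  by (rule norm_bound) simp

lemma abs_blinfun_bcontfun_le:
  fixes T :: "('x::real_normed_vector) \<Rightarrow>\<^sub>L ('k::topological_space \<Rightarrow>\<^sub>C real)"
  assumes "norm f \<le> b"
  shows "\<bar>apply_bcontfun (blinfun_apply T f) t\<bar> \<le> norm T * b"
proof -
  have "\<bar>apply_bcontfun (blinfun_apply T f) t\<bar> \<le> norm (T f)"
    by (rule abs_bcontfun_le_norm)
  also have "\<dots> \<le> norm T * norm f" by (rule norm_blinfun)
  also have "\<dots> \<le> norm T * b" using assms by (intro mult_left_mono) auto
  finally show ?thesis .
qed

section \<open>Partitions of unity of small diameter\<close>

lemma fine_partition_of_unity:
  assumes cpt: "compact (UNIV :: 'k::metric_space set)" and "e > 0"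
  obtains N :: nat and \<psi> :: "nat \<Rightarrow> ('k::metric_space) \<Rightarrow>\<^sub>C real"
  where "0 < N" "\<And>j t. 0 \<le> \<psi> j t" "\<And>t. (\<Sum>j<N. \<psi> j t) = 1"
    "\<And>j t t'. j < N \<Longrightarrow> \<psi> j t \<noteq> 0 \<Longrightarrow> \<psi> j t' \<noteq> 0 \<Longrightarrow> dist t t' < e"
proof -
  obtain Z :: "'k set" where Z: "finite Z" "UNIV \<subseteq> (\<Union>z\<in>Z. ball z (e/2))"
    using compactE_image[OF cpt, of UNIV "\<lambda>z. ball z (e/2)"] \<open>e > 0\<close> centre_in_ball
    by (metis (no_types, lifting) UNIV_I UN_I half_gt_zero open_ball subsetI)
  obtain z :: "nat \<Rightarrow> 'k" and N where zN: "Z = z ` {i. i < N}" 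
    using Z(1) finite_imp_nat_seg_image_inj_on by metis
  \<comment> \<open>Tent functions over a finite cover by balls of radius \<open>e/2\<close>. Their
    sum \<open>H\<close> is positive because the balls cover, so dividing by it gives the
    partition.\<close>
  define h where "h j t = max 0 (e/2 - dist (z j) t)" for j t
  have h0: "0 \<le> h j t" for j t by (simp add: h_def)
  define H where "H t = (\<Sum>j<N. h j t)" for t
  have H: "0 < H t" for t
  proof -
    obtain z' where "z' \<in> Z" "t \<in> ball z' (e/2)" using Z(2) by blast
    then obtain j where "j < N" "dist (z j) t < e/2" unfolding zN by auto
    then have "0 < h j t" by (simp add: h_def)
    then show ?thesis unfolding H_def using \<open>j < N\<close> h0 by (intro sum_pos2[of _ j]) auto
  qed
  have ch: "continuous_on UNIV (h j)" for j
    unfolding h_def by (intro continuous_intros)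
  have cH: "continuous_on UNIV H"
    unfolding H_def by (intro continuous_intros ch)
  define \<psi> where "\<psi> j = Bcontfun (\<lambda>t. h j t / H t)" for j
  have \<psi>: "\<psi> j t = h j t / H t" for j t
    unfolding \<psi>_def using H
    by (subst bcontfun_of_continuous[OF cpt]) (auto intro!: continuous_intros ch cH simp: less_imp_neq[symmetric])
  show ?thesis
  proof (rule that[of N \<psi>])
    show "0 < N" using zN Z(2) by (cases N) auto
    show "0 \<le> \<psi> j t" for j t using h0 H[of t] by (simp add: \<psi>)
    show "(\<Sum>j<N. \<psi> j t) = 1" for t
      using H[of t] by (simp add: \<psi> H_def flip: sum_divide_distrib)
    show "dist t t' < e" if "\<psi> j t \<noteq> 0" "\<psi> j t' \<noteq> 0" for j t t'
    proof -
      have "h j t \<noteq> 0" "h j t' \<noteq> 0" using that by (auto simp: \<psi>)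
      then have "dist (z j) t < e/2" "dist (z j) t' < e/2"
        by (auto simp: h_def max_def split: if_splits)
      then show ?thesis using dist_triangle3[of t t' "z j"] by linarith
    qed
  qed
qed

section \<open>Splitting a mass along a signed splitting\<close>

text \<open>Greedy allocation: the children receive the positive parts of \<open>m\<close> in order
  until \<open>l\<close> is used up, and a surplus of \<open>l\<close> over all positive parts goes
  to child 0. Writing the shares as differences of truncated partial sums makes them telescope and
  keeps them continuous in \<open>l\<close> and \<open>m\<close>.\<close>

definition split_mass :: "real \<Rightarrow> (nat \<Rightarrow> real) \<Rightarrow> nat \<Rightarrow> nat \<Rightarrow> real" where
  "split_mass l m N j =
     min (\<Sum>i<Suc j. max 0 (m i)) l - min (\<Sum>i<j. max 0 (m i)) l +
     (if j = 0 then max 0 (l - (\<Sum>i<N. max 0 (m i))) else 0)"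

lemma split_mass_nonneg: "0 \<le> split_mass l m N j"
  unfolding split_mass_def by (simp add: min_def max_def)

lemma sum_split_mass:
  assumes "0 < N" "0 \<le> l"
  shows "(\<Sum>j<N. split_mass l m N j) = l"
proof -
  have "(\<Sum>j<N. split_mass l m N j) =
      (\<Sum>j<N. min (\<Sum>i<Suc j. max 0 (m i)) l - min (\<Sum>i<j. max 0 (m i)) l)
      + max 0 (l - (\<Sum>i<N. max 0 (m i)))"
    unfolding split_mass_def sum.distrib using assms(1) by (simp add: sum.delta)
  also have "\<dots> = l"
    using assms(2) by (subst sum_lessThan_telescope) (simp add: min_def max_def)
  finally show ?thesis .
qed

text \<open>Each split may increase the total error, but by no more than the increase of total
  variation, so over all refinements the increase is bounded by the norm.\<close>

lemma split_mass_error: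
  assumes "0 < N" "0 \<le> l"
  shows "(\<Sum>j<N. \<bar>split_mass l m N j - m j\<bar>) \<le> \<bar>l - (\<Sum>j<N. m j)\<bar> + (\<Sum>j<N. \<bar>m j\<bar>) - \<bar>\<Sum>j<N. m j\<bar>"
proof -
  define A where "A = (\<Sum>j<N. max 0 (m j))"
  define D where "D = (\<Sum>j<N. max 0 (- m j))"
  have AD: "0 \<le> A" "0 \<le> D" unfolding A_def D_def by (auto intro: sum_nonneg)
  have m: "(\<Sum>j<N. m j) = A - D" "(\<Sum>j<N. \<bar>m j\<bar>) = A + D"
    unfolding A_def D_def sum_subtractf[symmetric] sum.distrib[symmetric]
    by (auto intro!: sum.cong simp: max_def)
  let ?c = "\<lambda>j. min (\<Sum>i<Suc j. max 0 (m i)) l - min (\<Sum>i<j. max 0 (m i)) l"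
  \<comment> \<open>The greedy share \<open>?c j\<close> never exceeds the positive part of
    \<open>m j\<close>, so the error consists of unserved positive part, surplus and negative
    part.\<close>
  have "\<bar>split_mass l m N j - m j\<bar> \<le>
      (max 0 (m j) - ?c j) + (if j = 0 then max 0 (l - A) else 0) + max 0 (- m j)" for j
    unfolding split_mass_def A_def by (auto simp: max_def min_def)
  then have "(\<Sum>j<N. \<bar>split_mass l m N j - m j\<bar>) \<le>
      (\<Sum>j<N. (max 0 (m j) - ?c j) + (if j = 0 then max 0 (l - A) else 0) + max 0 (- m j))"
    by (rule sum_mono)
  also have "\<dots> = (A - min A l) + max 0 (l - A) + D"
    using assms sum_lessThan_telescope[of "\<lambda>j. min (\<Sum>i<j. max 0 (m i)) l" N]
    by (simp add: sum.distrib sum_subtractf A_def D_def)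
  \<comment> \<open>The left side is |l - A| + D. If D <= A, the right side is |l - A + D| + 2 D and
    the triangle inequality applies; if A < D, it is l + A + D.\<close>
  also have "\<dots> \<le> \<bar>l - (A - D)\<bar> + (A + D) - \<bar>A - D\<bar>"
    using AD assms by (auto simp: max_def min_def abs_if)
  finally show ?thesis by (simp add: m)
qed

lemma continuous_on_split_mass:
  assumes "continuous_on S l" "\<And>i. continuous_on S (\<lambda>t. m t i)"
  shows "continuous_on S (\<lambda>t. split_mass (l t) (m t) N j)"
  unfolding split_mass_def by (cases "j = 0") (auto intro!: continuous_intros assms)

section \<open>Positive approximation of operators that almost preserve the unit\<close>

text \<open>A word lists the indices chosen at successive levels, newest index first. The mass
  \<open>weight s\<close> is a nonnegative substitute for the signed mass \<open>T (bump s)\<close>, additive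
  along the tree of words, and it is placed at the point \<open>node s\<close>. If \<open>bump s\<close> vanishes
  identically, \<open>node s\<close> is inherited from the parent, so that nodes still converge along branches.\<close>

locale refining_partitions =
  fixes N :: "nat \<Rightarrow> nat"
    and \<psi> :: "nat \<Rightarrow> nat \<Rightarrow> ('k::metric_space \<Rightarrow>\<^sub>C real)"
    and T :: "('k \<Rightarrow>\<^sub>C real) \<Rightarrow>\<^sub>L ('k \<Rightarrow>\<^sub>C real)"
  assumes cpt: "compact (UNIV :: 'k set)"
    and N_pos: "0 < N n"
    and \<psi>_nonneg: "0 \<le> \<psi> n j t"
    and \<psi>_sum: "(\<Sum>j<N n. \<psi> n j t) = 1"
    and \<psi>_diam: "j < N n \<Longrightarrow> \<psi> n j t \<noteq> 0 \<Longrightarrow> \<psi> n j t' \<noteq> 0 \<Longrightarrow> dist t t' < inverse (real (Suc n))"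
begin

section \<open>The tree of words and its masses\<close>

primrec words :: "nat \<Rightarrow> nat list set" where
  "words 0 = {[]}"
| "words (Suc n) = (\<lambda>(s, j). j # s) ` (words n \<times> {..<N n})"

primrec bump :: "nat list \<Rightarrow> ('k \<Rightarrow>\<^sub>C real)" where
  "bump [] = 1"
| "bump (j # s) = bump s * \<psi> (length s) j"

primrec weight :: "nat list \<Rightarrow> 'k \<Rightarrow> real" where
  "weight [] t = 1"
| "weight (j # s) t = split_mass (weight s t) (\<lambda>i. T (bump (i # s)) t) (N (length s)) j"

primrec node :: "nat list \<Rightarrow> 'k" where
  "node [] = undefined"
| "node (j # s) = (if \<exists>y. bump (j # s) y \<noteq> 0 then SOME y. bump (j # s) y \<noteq> 0 else node s)"

lemma length_words: "s \<in> words n \<Longrightarrow> length s = n"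
  by (induction n arbitrary: s) auto

lemma words_Suc_not_Nil: "s \<in> words (Suc n) \<Longrightarrow> s \<noteq> []"
  by auto

lemma sum_words_Suc: "(\<Sum>s\<in>words (Suc n). F s) = (\<Sum>s\<in>words n. \<Sum>j<N n. F (j # s))"
  for F :: "nat list \<Rightarrow> 'c::comm_monoid_add"
proof -
  have inj: "inj_on (\<lambda>(s, j). j # s) (words n \<times> {..<N n})"
    by (auto simp: inj_on_def)
  show ?thesis
    unfolding words.simps sum.reindex[OF inj] sum.cartesian_product
    by (simp add: case_prod_beta' o_def)
qed

lemma bump_nonneg: "0 \<le> bump s t"
  by (induction s) (auto intro!: mult_nonneg_nonneg \<psi>_nonneg)

lemma sum_bump: "(\<Sum>s\<in>words n. bump s t) = 1"
proof (induction n)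
  case (Suc n)
  have "(\<Sum>s\<in>words (Suc n). bump s t) = (\<Sum>s\<in>words n. \<Sum>j<N n. bump s t * \<psi> n j t)"
    by (simp only: sum_words_Suc) (simp add: length_words)
  also have "\<dots> = 1" using Suc by (simp add: \<psi>_sum flip: sum_distrib_left)
  finally show ?case .
qed simp

lemma bump_split: "(\<Sum>j<N (length s). bump (j # s)) = bump s"
  by (rule bcontfun_eqI) (simp add: sum_bcontfun_apply \<psi>_sum flip: sum_distrib_left)

lemma T_bump_split: "(\<Sum>j<N (length s). T (bump (j # s)) t) = T (bump s) t"
  by (metis bump_split blinfun.sum_right sum_bcontfun_apply)

lemma weight_nonneg: "0 \<le> weight s t"
  by (cases s) (auto simp: split_mass_nonneg)

lemma weight_split:
  assumes "s \<in> words n"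
  shows "(\<Sum>j<N n. weight (j # s) t) = weight s t"
  using length_words[OF assms] by (simp add: sum_split_mass N_pos weight_nonneg)

lemma continuous_on_weight: "continuous_on UNIV (weight s)"
proof (induction s)
  case Nil
  have "weight [] = (\<lambda>_. 1)" by auto
  then show ?case by simp
next
  case (Cons j s)
  have "weight (j # s) = (\<lambda>t. split_mass (weight s t) (\<lambda>i. T (bump (i # s)) t) (N (length s)) j)"
    by auto
  with Cons show ?case
    by (simp only:) (intro continuous_on_split_mass continuous_on_apply_bcontfun)
qed

lemma sum_weight: "(\<Sum>s\<in>words n. weight s t) = 1"
proof (induction n)
  case (Suc n)
  have "(\<Sum>s\<in>words (Suc n). weight s t) = (\<Sum>s\<in>words n. weight s t)"
    by (simp only: sum_words_Suc) (auto intro!: sum.cong weight_split simp del: weight.simps)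
  with Suc show ?case by simp
qed simp

text \<open>Duality: \<open>T\<close> is tested on the combination of bumps whose coefficients are
  the signs of \<open>T (bump s) t\<close>. It has norm at most 1 because the bumps are nonnegative
  and sum to 1.\<close>

lemma variation_le: "(\<Sum>s\<in>words n. \<bar>T (bump s) t\<bar>) \<le> norm T"
proof -
  define f where "f = (\<Sum>s\<in>words n. sgn (T (bump s) t) *\<^sub>R bump s)"
  have "\<bar>f y\<bar> \<le> 1" for y
  proof -
    have "\<bar>f y\<bar> \<le> (\<Sum>s\<in>words n. \<bar>sgn (T (bump s) t) * bump s y\<bar>)"
      unfolding f_def sum_bcontfun_apply by (simp add: sum_abs)
    also have "\<dots> \<le> (\<Sum>s\<in>words n. bump s y)"
      by (rule sum_mono) (auto simp: abs_mult bump_nonneg abs_sgn_eq)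
    finally show ?thesis by (simp add: sum_bump)
  qed
  then have "norm f \<le> 1" by (rule norm_bcontfun_le)
  then have "\<bar>T f t\<bar> \<le> norm T * 1" by (rule abs_blinfun_bcontfun_le)
  moreover have "T f t = (\<Sum>s\<in>words n. \<bar>T (bump s) t\<bar>)"
    unfolding f_def blinfun.sum_right sum_bcontfun_apply
    by (simp add: blinfun.scaleR_right abs_sgn mult.commute)
  ultimately show ?thesis by simp
qed

text \<open>By \<open>split_mass_error\<close>, total error minus total variation does not increase
  from one level to the next. At the root it equals |1 - T 1 t| - |T 1 t|, and the variation never
  exceeds \<open>norm T\<close>, so the bound is uniform in \<open>n\<close>.\<close>

lemma weight_error:
  "(\<Sum>s\<in>words n. \<bar>weight s t - T (bump s) t\<bar>) \<le> \<bar>1 - T 1 t\<bar> + norm T - \<bar>T 1 t\<bar>"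
proof -
  have "(\<Sum>s\<in>words n. \<bar>weight s t - T (bump s) t\<bar>)
      \<le> \<bar>1 - T 1 t\<bar> + (\<Sum>s\<in>words n. \<bar>T (bump s) t\<bar>) - \<bar>T 1 t\<bar>"
  proof (induction n)
    case (Suc n)
    have "(\<Sum>j<N n. \<bar>weight (j # s) t - T (bump (j # s)) t\<bar>) \<le>
        \<bar>weight s t - T (bump s) t\<bar> + (\<Sum>j<N n. \<bar>T (bump (j # s)) t\<bar>) - \<bar>T (bump s) t\<bar>"
      if "s \<in> words n" for s
      using split_mass_error[OF N_pos[of n] weight_nonneg[of s t], of "\<lambda>j. T (bump (j # s)) t"]
        T_bump_split[of s t] length_words[OF that] by simp
    then have "(\<Sum>s\<in>words (Suc n). \<bar>weight s t - T (bump s) t\<bar>) \<le>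
        (\<Sum>s\<in>words n. \<bar>weight s t - T (bump s) t\<bar> + (\<Sum>j<N n. \<bar>T (bump (j # s)) t\<bar>) - \<bar>T (bump s) t\<bar>)"
      by (simp only: sum_words_Suc) (rule sum_mono)
    also have "\<dots> \<le> \<bar>1 - T 1 t\<bar> + (\<Sum>s\<in>words (Suc n). \<bar>T (bump s) t\<bar>) - \<bar>T 1 t\<bar>"
      using Suc by (simp add: sum.distrib sum_subtractf sum_words_Suc del: bump.simps words.simps)
    finally show ?case .
  qed simp
  with variation_le[of t n] show ?thesis by simp
qed

section \<open>Drift of nodes along branches\<close>

lemma bump_node: "bump s y \<noteq> 0 \<Longrightarrow> s \<noteq> [] \<Longrightarrow> bump s (node s) \<noteq> 0"
proof (cases s)
  case (Cons j r)
  assume "bump s y \<noteq> 0"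
  then have *: "\<exists>y. bump (j # r) y \<noteq> 0" using Cons by blast
  then show ?thesis using someI_ex[OF *] Cons by (simp del: bump.simps)
qed simp

lemma bump_append_nonzero: "bump (s' @ s) y \<noteq> 0 \<Longrightarrow> bump s y \<noteq> 0"
  by (induction s') auto

text \<open>The newest index of a word of length \<open>Suc n\<close> comes from the partition of
  level \<open>n\<close>, whose diameters are below 1/(n+1).\<close>

lemma dist_bump:
  assumes "s \<in> words (Suc n)" "bump s y \<noteq> 0" "bump s y' \<noteq> 0"
  shows "dist y y' < inverse (real (Suc n))"
  using assms \<psi>_diam by (auto simp: length_words)

text \<open>A node below \<open>s\<close> is either inherited all the way from \<open>s\<close> or
  was chosen in the support of some descendant bump, which lies inside the support of
  \<open>bump s\<close>.\<close>

lemma node_append: "node (s' @ s) = node s \<or> bump s (node (s' @ s)) \<noteq> 0"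
proof (induction s')
  case (Cons j s')
  show ?case
  proof (cases "\<exists>y. bump (j # s' @ s) y \<noteq> 0")
    case True
    then have "bump ((j # s') @ s) (node ((j # s') @ s)) \<noteq> 0"
      using bump_node by (metis append_Cons list.distinct(1))
    then show ?thesis using bump_append_nonzero by blast
  next
    case False
    then have "node ((j # s') @ s) = node (s' @ s)" by auto
    with Cons show ?thesis by simp
  qed
qed simp

text \<open>Makes nodes converge uniformly along branches. Words here are nonempty because the node
  of the root is arbitrary.\<close>

lemma dist_node_append:
  assumes "s \<in> words (Suc n)"
  shows "dist (node (s' @ s)) (node s) < inverse (real (Suc n))"
proof (cases "node (s' @ s) = node s")
  case False
  then have "bump s (node (s' @ s)) \<noteq> 0" using node_append by blast
  moreover from this have "bump s (node s) \<noteq> 0"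
    by (rule bump_node[OF _ words_Suc_not_Nil[OF assms]])
  ultimately show ?thesis using dist_bump[OF assms] by blast
qed simp

lemma drop_words: "s \<in> words (n + i) \<Longrightarrow> drop i s \<in> words n"
  by (induction i arbitrary: s) auto

text \<open>\<open>drop i s\<close> is the ancestor \<open>i\<close> levels up, and the masses of
  all its descendants at one level add up to its own mass.\<close>

lemma sum_weight_drop:
  "(\<Sum>s\<in>words (n + i). weight s t * F (drop i s)) = (\<Sum>s\<in>words n. weight s t * F s)"
proof (induction i)
  case (Suc i)
  have "(\<Sum>s\<in>words (n + Suc i). weight s t * F (drop (Suc i) s)) =
      (\<Sum>s\<in>words (n + i). (\<Sum>j<N (n + i). weight (j # s) t) * F (drop i s))"
    unfolding add_Suc_right sum_words_Suc sum_distrib_right drop_Suc_Cons ..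
  also have "\<dots> = (\<Sum>s\<in>words (n + i). weight s t * F (drop i s))"
    by (auto intro!: sum.cong simp: weight_split simp del: weight.simps)
  finally show ?case using Suc by simp
qed simp

section \<open>Discrete averages and their limit operator\<close>

text \<open>For fixed \<open>t\<close> this is integration against the discrete probability measure
  with mass \<open>weight s t\<close> at \<open>node s\<close>. Such averages are positive and
  unital in \<open>f\<close>.\<close>

definition level :: "nat \<Rightarrow> ('k \<Rightarrow>\<^sub>C real) \<Rightarrow> ('k \<Rightarrow>\<^sub>C real)" where
  "level n f = Bcontfun (\<lambda>t. \<Sum>s\<in>words n. weight s t * f (node s))"

lemma level_apply [simp]: "level n f t = (\<Sum>s\<in>words n. weight s t * f (node s))"
  unfolding level_def
  by (subst bcontfun_of_continuous[OF cpt]) (intro continuous_intros continuous_on_weight, simp)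

lemma oscillation:
  fixes f :: "'k \<Rightarrow>\<^sub>C real"
  assumes "0 < e"
  obtains n where "\<And>m y y'. n \<le> m \<Longrightarrow> dist y y' < inverse (real (Suc m)) \<Longrightarrow> \<bar>f y - f y'\<bar> < e"
proof -
  have "uniformly_continuous_on UNIV f"
    by (intro compact_uniformly_continuous cpt continuous_on_apply_bcontfun)
  then obtain d where "0 < d" and d: "\<And>y y'. dist y y' < d \<Longrightarrow> \<bar>f y - f y'\<bar> < e"
    using assms by (auto simp: uniformly_continuous_on_def dist_real_def)
  obtain n where n: "inverse (real (Suc n)) < d" using reals_Archimedean[OF \<open>0 < d\<close>] by blast
  have "inverse (real (Suc m)) \<le> inverse (real (Suc n))" if "n \<le> m" for m
    using that by (simp add: field_simps)
  with n d show ?thesis by (meson that order.strict_trans order.strict_trans1 order_less_le_trans)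
qed

text \<open>Moving the masses of the finer level back to their ancestors' nodes recovers the coarser
  average, and every mass travels less than 1/(n+1).\<close>

lemma level_close:
  fixes f :: "'k \<Rightarrow>\<^sub>C real"
  assumes osc: "\<And>y y'. dist y y' < inverse (real (Suc n)) \<Longrightarrow> \<bar>f y - f y'\<bar> < e"
  shows "\<bar>level (Suc n + i) f t - level (Suc n) f t\<bar> \<le> e"
proof -
  have "level (Suc n) f t = (\<Sum>s\<in>words (Suc n + i). weight s t * f (node (drop i s)))"
    using sum_weight_drop[where n = "Suc n" and i = i and t = t and F = "\<lambda>s. f (node s)"] by (simp del: words.simps)
  then have "\<bar>level (Suc n + i) f t - level (Suc n) f t\<bar> =
      \<bar>\<Sum>s\<in>words (Suc n + i). weight s t * (f (node s) - f (node (drop i s)))\<bar>"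
    by (simp add: sum_subtractf right_diff_distrib del: words.simps)
  also have "\<dots> \<le> (\<Sum>s\<in>words (Suc n + i). weight s t * e)"
  proof (rule sum_abs[THEN order_trans], rule sum_mono)
    fix s assume s: "s \<in> words (Suc n + i)"
    have "dist (node (take i s @ drop i s)) (node (drop i s)) < inverse (real (Suc n))"
      by (rule dist_node_append[OF drop_words[OF s]])
    then have "\<bar>f (node s) - f (node (drop i s))\<bar> \<le> e" using osc by force
    then show "\<bar>weight s t * (f (node s) - f (node (drop i s)))\<bar> \<le> weight s t * e"
      by (simp add: abs_mult weight_nonneg mult_left_mono)
  qed
  also have "\<dots> = e" by (simp add: sum_weight flip: sum_distrib_right del: words.simps)
  finally show ?thesis .
qed

lemma Cauchy_level: "Cauchy (\<lambda>n. level n f)"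
proof (rule metric_CauchyI)
  fix e :: real assume "0 < e"
  then obtain n where n: "\<And>m y y'. n \<le> m \<Longrightarrow> dist y y' < inverse (real (Suc m)) \<Longrightarrow> \<bar>f y - f y'\<bar> < e / 3"
    using oscillation[of "e/3" f] by auto
  have close: "dist (level m f) (level (Suc n) f) \<le> e / 3" if "Suc n \<le> m" for m
  proof (rule dist_bound)
    fix t
    obtain i where m: "m = Suc n + i" using \<open>Suc n \<le> m\<close> le_Suc_ex by blast
    have "\<bar>level m f t - level (Suc n) f t\<bar> \<le> e / 3"
      unfolding m by (rule level_close) (use n[OF order_refl] in blast)
    then show "dist (level m f t) (level (Suc n) f t) \<le> e / 3" by (simp only: dist_real_def)
  qed
  have "dist (level m f) (level m' f) < e" if "Suc n \<le> m" "Suc n \<le> m'" for m m'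
    using dist_triangle2[of "level m f" "level m' f" "level (Suc n) f"] close[of m] close[of m']
      that \<open>0 < e\<close> by linarith
  then show "\<exists>M. \<forall>m\<ge>M. \<forall>n\<ge>M. dist (level m f) (level n f) < e" by blast
qed

text \<open>Replacing \<open>f\<close> by the combination \<open>g\<close> of bumps with its node
  values costs \<open>norm T * e\<close>. After that, \<open>T g\<close> and the average are sums
  with the same node values, and their coefficients differ by the error of the masses.\<close>

lemma level_error:
  fixes f :: "'k \<Rightarrow>\<^sub>C real"
  assumes osc: "\<And>y y'. dist y y' < inverse (real (Suc n)) \<Longrightarrow> \<bar>f y - f y'\<bar> < e"
  shows "\<bar>level (Suc n) f t - T f t\<bar> \<le> (\<bar>1 - T 1 t\<bar> + norm T - \<bar>T 1 t\<bar>) * norm f + norm T * e"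
proof -
  define g where "g = (\<Sum>s\<in>words (Suc n). f (node s) *\<^sub>R bump s)"
  have "\<bar>(g - f) y\<bar> \<le> e" for y
  proof -
    have "f y = (\<Sum>s\<in>words (Suc n). bump s y * f y)"
      by (simp only: sum_bump flip: sum_distrib_right)
    then have "\<bar>(g - f) y\<bar> = \<bar>\<Sum>s\<in>words (Suc n). bump s y * (f (node s) - f y)\<bar>"
      unfolding g_def
      by (simp add: sum_bcontfun_apply right_diff_distrib sum_subtractf mult.commute del: words.simps)
    also have "\<dots> \<le> (\<Sum>s\<in>words (Suc n). bump s y * e)"
    proof (rule sum_abs[THEN order_trans], rule sum_mono)
      fix s assume s: "s \<in> words (Suc n)"
      show "\<bar>bump s y * (f (node s) - f y)\<bar> \<le> bump s y * e"
      \<comment> \<open>If \<open>bump s\<close> vanishes at \<open>y\<close>, its node may be far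
        away, but then the summand is zero.\<close>
      proof (cases "bump s y = 0")
        case False
        then have "bump s (node s) \<noteq> 0" using bump_node words_Suc_not_Nil[OF s] by blast
        then have "\<bar>f (node s) - f y\<bar> \<le> e"
          using False s by (intro less_imp_le osc dist_bump)
        then show ?thesis by (simp add: abs_mult bump_nonneg mult_left_mono)
      qed simp
    qed
    also have "\<dots> = e" by (simp add: sum_bump flip: sum_distrib_right del: words.simps)
    finally show ?thesis .
  qed
  then have "norm (g - f) \<le> e" by (rule norm_bcontfun_le)
  then have 1: "\<bar>T (g - f) t\<bar> \<le> norm T * e" by (rule abs_blinfun_bcontfun_le)
  have Tg: "T g t = (\<Sum>s\<in>words (Suc n). T (bump s) t * f (node s))"
    unfolding g_def blinfun.sum_right sum_bcontfun_apply
    by (simp add: blinfun.scaleR_right mult.commute)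
  have "\<bar>level (Suc n) f t - T g t\<bar> = \<bar>\<Sum>s\<in>words (Suc n). (weight s t - T (bump s) t) * f (node s)\<bar>"
    by (simp add: Tg left_diff_distrib sum_subtractf del: words.simps)
  also have "\<dots> \<le> (\<Sum>s\<in>words (Suc n). \<bar>weight s t - T (bump s) t\<bar> * norm f)"
    by (rule sum_abs[THEN order_trans], rule sum_mono)
      (auto simp: abs_mult intro!: mult_left_mono abs_bcontfun_le_norm)
  also have "\<dots> \<le> (\<bar>1 - T 1 t\<bar> + norm T - \<bar>T 1 t\<bar>) * norm f"
    unfolding sum_distrib_right[symmetric] by (intro mult_right_mono weight_error norm_ge_zero)
  finally show ?thesis using 1 by (simp add: blinfun.diff_right)
qed

lemma positive_operator:
  obtains S :: "('k \<Rightarrow>\<^sub>C real) \<Rightarrow>\<^sub>L ('k \<Rightarrow>\<^sub>C real)" where "S 1 = 1"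
    "\<And>f t. (\<And>y. 0 \<le> apply_bcontfun f y) \<Longrightarrow> 0 \<le> S f t"
    "\<And>f t. \<bar>S f t - T f t\<bar> \<le> (\<bar>1 - T 1 t\<bar> + norm T - \<bar>T 1 t\<bar>) * norm f"
proof -
  define L where "L f = lim (\<lambda>n. level n f)" for f
  have lim: "(\<lambda>n. level n f) \<longlonglongrightarrow> L f" for f
    unfolding L_def using Cauchy_level Cauchy_convergent_iff convergent_LIMSEQ_iff by blast
  have limt: "(\<lambda>n. level n f t) \<longlonglongrightarrow> L f t" for f t
    using tendsto_bcontfun_uniform_limit[OF lim] by (rule tendsto_uniform_limitI) simp
  have level_norm: "\<bar>level n f t\<bar> \<le> norm f" for n f t
  proof -
    have "\<bar>level n f t\<bar> \<le> (\<Sum>s\<in>words n. weight s t * norm f)"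
      unfolding level_apply
      by (rule sum_abs[THEN order_trans], rule sum_mono)
        (auto simp: abs_mult weight_nonneg intro!: mult_left_mono abs_bcontfun_le_norm)
    then show ?thesis by (simp add: sum_weight flip: sum_distrib_right)
  qed
  have "bounded_linear L"
  proof
    show "L (f + g) = L f + L g" for f g
    proof (rule LIMSEQ_unique[OF lim])
      have "level n (f + g) = level n f + level n g" for n
        by (rule bcontfun_eqI) (simp add: ring_distribs sum.distrib)
      then show "(\<lambda>n. level n (f + g)) \<longlonglongrightarrow> L f + L g"
        using tendsto_add[OF lim lim] by simp
    qed
    show "L (c *\<^sub>R f) = c *\<^sub>R L f" for c f
    proof (rule LIMSEQ_unique[OF lim])
      have "level n (c *\<^sub>R f) = c *\<^sub>R level n f" for n
        by (rule bcontfun_eqI) (simp add: sum_distrib_left mult_ac)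
      then show "(\<lambda>n. level n (c *\<^sub>R f)) \<longlonglongrightarrow> c *\<^sub>R L f"
        using tendsto_scaleR[OF tendsto_const lim] by simp
    qed
    have "norm (L f) \<le> norm f * 1" for f
      using LIMSEQ_le_const2[OF tendsto_norm[OF lim]] norm_bcontfun_le[OF level_norm] by force
    then show "\<exists>K. \<forall>f. norm (L f) \<le> norm f * K" by blast
  qed
  then have S: "blinfun_apply (Blinfun L) = L" by (rule bounded_linear_Blinfun_apply)
  show ?thesis
  proof (rule that[of "Blinfun L"]; (unfold S)?)
    have "level n 1 = 1" for n
      by (rule bcontfun_eqI) (simp add: sum_weight)
    then show "L 1 = 1" using lim[of 1] by (simp add: LIMSEQ_const_iff)
    show "0 \<le> L f t" if "\<And>y. 0 \<le> f y" for f :: "'k \<Rightarrow>\<^sub>C real" and t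
      using LIMSEQ_le_const[OF limt, of 0 f t] that
      by (auto intro!: sum_nonneg mult_nonneg_nonneg weight_nonneg)
    show "\<bar>L f t - T f t\<bar> \<le> (\<bar>1 - T 1 t\<bar> + norm T - \<bar>T 1 t\<bar>) * norm f" (is "_ \<le> ?c") for f t
    proof (rule field_le_epsilon)
      fix e :: real assume "0 < e"
      \<comment> \<open>Chosen so that \<open>norm T * d \<le> e\<close>; adding 1 avoids division
        by zero when \<open>T = 0\<close>.\<close>
      define d where "d = e / (norm T + 1)"
      have "0 < d" using \<open>0 < e\<close> by (auto simp: d_def intro!: divide_pos_pos add_nonneg_pos)
      then obtain n where n: "\<And>m y y'. n \<le> m \<Longrightarrow> dist y y' < inverse (real (Suc m)) \<Longrightarrow> \<bar>f y - f y'\<bar> < d"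
        using oscillation by blast
      have "\<bar>level m f t - T f t\<bar> \<le> ?c + norm T * d" if "Suc n \<le> m" for m
        using that level_error[OF n] by (cases m) auto
      then have "\<bar>L f t - T f t\<bar> \<le> ?c + norm T * d"
        by (intro LIMSEQ_le_const2[OF tendsto_rabs[OF tendsto_diff[OF limt tendsto_const]]]) blast
      also have "norm T * d \<le> e"
        using \<open>0 < e\<close> by (simp add: d_def divide_simps add_nonneg_pos mult_left_mono)
      finally show "\<bar>L f t - T f t\<bar> \<le> ?c + e" by simp
    qed
  qed
qed

end

lemma positive_approximation:
  fixes T :: "('k::metric_space \<Rightarrow>\<^sub>C real) \<Rightarrow>\<^sub>L ('k \<Rightarrow>\<^sub>C real)"
  assumes cpt: "compact (UNIV :: 'k set)"
  obtains S :: "('k \<Rightarrow>\<^sub>C real) \<Rightarrow>\<^sub>L ('k \<Rightarrow>\<^sub>C real)" where "S 1 = 1"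
    "\<And>f t. (\<And>y. 0 \<le> apply_bcontfun f y) \<Longrightarrow> 0 \<le> S f t"
    "\<And>f t. \<bar>S f t - T f t\<bar> \<le> (\<bar>1 - T 1 t\<bar> + norm T - \<bar>T 1 t\<bar>) * norm f"
proof -
  define P :: "nat \<Rightarrow> nat \<times> (nat \<Rightarrow> 'k \<Rightarrow>\<^sub>C real) \<Rightarrow> bool" where
    "P n p \<longleftrightarrow> 0 < fst p \<and> (\<forall>j t. 0 \<le> snd p j t) \<and> (\<forall>t. (\<Sum>j<fst p. snd p j t) = 1) \<and>
      (\<forall>j t t'. j < fst p \<longrightarrow> snd p j t \<noteq> 0 \<longrightarrow> snd p j t' \<noteq> 0 \<longrightarrow> dist t t' < inverse (real (Suc n)))" for n p
  have "\<exists>p. P n p" for n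
  proof -
    obtain N :: nat and \<psi> :: "nat \<Rightarrow> 'k \<Rightarrow>\<^sub>C real" where "P n (N, \<psi>)"
      using fine_partition_of_unity[OF cpt, of "inverse (real (Suc n))"] unfolding P_def fst_conv snd_conv
      by (metis inverse_positive_iff_positive of_nat_0_less_iff zero_less_Suc)
    then show ?thesis by blast
  qed
  then obtain p where "\<And>n. P n (p n)" by metis
  then interpret refining_partitions "\<lambda>n. fst (p n)" "\<lambda>n. snd (p n)" T
    by unfold_locales (use cpt in \<open>auto simp: P_def\<close>)
  show ?thesis using positive_operator that by blast
qed

section \<open>Functionals and numerical radius\<close>

definition eval_at :: "'k::topological_space \<Rightarrow> ('k \<Rightarrow>\<^sub>C real) \<Rightarrow>\<^sub>L real" where
  "eval_at t = Blinfun (\<lambda>u. apply_bcontfun u t)"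

lemma eval_at_apply [simp]: "blinfun_apply (eval_at t) u = apply_bcontfun u t"
proof -
  have "bounded_linear (\<lambda>u :: 'a \<Rightarrow>\<^sub>C real. apply_bcontfun u t)"
    by (rule bounded_linear_intro[of _ 1]) (auto intro: abs_bcontfun_le_norm)
  then show ?thesis by (simp add: eval_at_def bounded_linear_Blinfun_apply)
qed

lemma norm_eval_at [simp]: "norm (eval_at t) = 1"
proof (rule antisym)
  show "norm (eval_at t) \<le> 1"
    by (rule norm_blinfun_bound) (auto intro: abs_bcontfun_le_norm)
  show "1 \<le> norm (eval_at t)"
    using norm_blinfun[of "eval_at t" 1] by simp
qed

section \<open>Numerical radius and operator norm\<close>

lemma state_pair_apply_le_norm:
  fixes T :: "'x::banach \<Rightarrow>\<^sub>L 'x"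
  assumes "(x, f) \<in> state_pairs"
  shows "\<bar>blinfun_apply f (T x)\<bar> \<le> norm T"
proof -
  have "norm x = 1" "norm f = 1" using assms by (auto simp: state_pairs_def)
  then show ?thesis
    using norm_blinfun[of f "T x"] norm_blinfun[of T x] by simp
qed

lemma state_pair_le_numerical_radius:
  fixes T :: "'x::banach \<Rightarrow>\<^sub>L 'x"
  assumes "(x, f) \<in> state_pairs"
  shows "\<bar>blinfun_apply f (T x)\<bar> \<le> numerical_radius T"
  unfolding numerical_radius_def
  by (rule cSup_upper) (use assms state_pair_apply_le_norm in \<open>auto intro!: bdd_aboveI\<close>)

text \<open>The given state pair guarantees that the supremum is taken over a nonempty set.\<close>

lemma numerical_radius_le_norm:
  fixes T :: "'x::banach \<Rightarrow>\<^sub>L 'x" and x :: 'x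
  assumes "(x, f) \<in> state_pairs"
  shows "numerical_radius T \<le> norm T"
  unfolding numerical_radius_def
  by (rule cSup_least) (use assms state_pair_apply_le_norm in auto)

text \<open>Where |u t| = 1, the evaluation at \<open>t\<close> multiplied by the sign
  \<open>u t\<close> is a norming functional of \<open>u\<close>.\<close>

lemma abs_apply_le_numerical_radius_peak:
  fixes T :: "('k::metric_space \<Rightarrow>\<^sub>C real) \<Rightarrow>\<^sub>L ('k \<Rightarrow>\<^sub>C real)" and u :: "'k \<Rightarrow>\<^sub>C real"
  assumes "norm u \<le> 1" "\<bar>u t\<bar> = 1"
  shows "\<bar>T u t\<bar> \<le> numerical_radius T"
proof -
  have "norm u = 1" using assms abs_bcontfun_le_norm[of u t] by simp
  moreover have "u t * u t = 1" using assms(2) by (metis abs_mult_self_eq mult_1)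
  ultimately have "(u, u t *\<^sub>R eval_at t) \<in> state_pairs"
    using assms(2) by (simp add: state_pairs_def blinfun.scaleR_left)
  from state_pair_le_numerical_radius[OF this, of T] show ?thesis
    using assms by (simp add: blinfun.scaleR_left abs_mult)
qed

text \<open>A function of norm at most 1 is, up to a small error, a convex combination of two
  functions of norm at most 1 with values 1 and -1 at the given point.\<close>

lemma norm_le_numerical_radius:
  fixes T :: "('k::metric_space \<Rightarrow>\<^sub>C real) \<Rightarrow>\<^sub>L ('k \<Rightarrow>\<^sub>C real)"
  assumes cpt: "compact (UNIV :: 'k set)"
  shows "norm T \<le> numerical_radius T"
proof -
  have unit: "\<bar>T u t\<bar> \<le> numerical_radius T" if u: "norm u \<le> 1" for u :: "'k \<Rightarrow>\<^sub>C real" and t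
  proof (rule field_le_epsilon)
    fix e :: real assume "0 < e"
    define d where "d = e / (norm T + 1)"
    have "0 < d" using \<open>0 < e\<close> by (auto simp: d_def intro!: divide_pos_pos add_nonneg_pos)
    have Td: "norm T * d \<le> e"
      using \<open>0 < e\<close> by (simp add: d_def divide_simps add_nonneg_pos mult_left_mono)
    have ub: "-1 \<le> u y" "u y \<le> 1" for y
      using abs_bcontfun_le_norm[of u y] u by auto
    \<comment> \<open>A peak at \<open>t\<close> that vanishes where \<open>u\<close> differs from
      \<open>u t\<close> by at least \<open>d\<close>. It pushes \<open>u\<close> up to 1 at
      \<open>t\<close> in \<open>u1\<close> and down to -1 in \<open>u2\<close>.\<close>
    define \<phi> where "\<phi> = Bcontfun (\<lambda>y. max 0 (1 - \<bar>u y - u t\<bar> / d))"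
    have \<phi>: "\<phi> y = max 0 (1 - \<bar>u y - u t\<bar> / d)" for y
      unfolding \<phi>_def using \<open>0 < d\<close>
      by (subst bcontfun_of_continuous[OF cpt]) (auto intro!: continuous_intros)
    have \<phi>b: "0 \<le> \<phi> y" "\<phi> y \<le> 1" for y using \<open>0 < d\<close> by (auto simp: \<phi>)
    have \<phi>t: "\<phi> t = 1" by (simp add: \<phi>)
    define c where "c = u t"
    define u1 where "u1 = u + (1 - u) * \<phi>"
    define u2 where "u2 = u - (1 + u) * \<phi>"
    \<comment> \<open>The convex combination of \<open>u1\<close> and \<open>u2\<close> with mean
      value \<open>c\<close> at \<open>t\<close> exceeds \<open>u\<close> by exactly
      \<open>w\<close>, which has norm at most \<open>d\<close> by the choice of \<phi>.\<close>
    define w where "w = (c *\<^sub>R 1 - u) * \<phi>"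
    have u_eq: "u = ((1 + c) / 2) *\<^sub>R u1 + ((1 - c) / 2) *\<^sub>R u2 - w"
      by (rule bcontfun_eqI) (simp add: u1_def u2_def w_def field_simps)
    have "\<bar>T u1 t\<bar> \<le> numerical_radius T"
    proof (rule abs_apply_le_numerical_radius_peak)
      have "\<bar>u1 y\<bar> \<le> 1" for y
      proof -
        have "0 \<le> (1 - u y) * \<phi> y" "0 \<le> (1 - u y) * (1 - \<phi> y)"
          using ub[of y] \<phi>b[of y] by simp_all
        then show ?thesis using ub[of y] by (simp add: u1_def algebra_simps)
      qed
      then show "norm u1 \<le> 1" by (rule norm_bcontfun_le)
      show "\<bar>u1 t\<bar> = 1" by (simp add: u1_def \<phi>t)
    qed
    moreover have "\<bar>T u2 t\<bar> \<le> numerical_radius T"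
    proof (rule abs_apply_le_numerical_radius_peak)
      have "\<bar>u2 y\<bar> \<le> 1" for y
      proof -
        have "0 \<le> (1 + u y) * \<phi> y" "0 \<le> (1 + u y) * (1 - \<phi> y)"
          using ub[of y] \<phi>b[of y] by simp_all
        then show ?thesis using ub[of y] by (simp add: u2_def algebra_simps)
      qed
      then show "norm u2 \<le> 1" by (rule norm_bcontfun_le)
      show "\<bar>u2 t\<bar> = 1" by (simp add: u2_def \<phi>t)
    qed
    moreover have "\<bar>T w t\<bar> \<le> e"
    proof -
      have "\<bar>w y\<bar> \<le> d" for y
      proof (cases "\<bar>u y - c\<bar> \<le> d")
        case True
        then have "\<bar>c - u y\<bar> * \<bar>\<phi> y\<bar> \<le> d * 1"
          using \<phi>b[of y] \<open>0 < d\<close> by (intro mult_mono) auto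
        then show ?thesis by (simp add: w_def abs_mult)
      next
        case False
        then have "\<phi> y = 0" using \<open>0 < d\<close> by (simp add: \<phi> c_def max_def)
        then show ?thesis using \<open>0 < d\<close> by (simp add: w_def)
      qed
      then show ?thesis
        using abs_blinfun_bcontfun_le[OF norm_bcontfun_le, of w d T t] Td by simp
    qed
    moreover have "\<bar>T u t\<bar> \<le> (1 + c) / 2 * \<bar>T u1 t\<bar> + (1 - c) / 2 * \<bar>T u2 t\<bar> + \<bar>T w t\<bar>"
    proof -
      have "T u t = (1 + c) / 2 * T u1 t + (1 - c) / 2 * T u2 t - T w t"
        by (subst u_eq) (simp add: blinfun.add_right blinfun.diff_right blinfun.scaleR_right)
      moreover have "\<bar>(1 + c) / 2 * T u1 t\<bar> = (1 + c) / 2 * \<bar>T u1 t\<bar>"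
        "\<bar>(1 - c) / 2 * T u2 t\<bar> = (1 - c) / 2 * \<bar>T u2 t\<bar>"
        using ub[of t] by (simp_all add: abs_mult c_def)
      ultimately show ?thesis by linarith
    qed
    moreover have "(1 + c) / 2 * \<bar>T u1 t\<bar> + (1 - c) / 2 * \<bar>T u2 t\<bar> \<le>
        (1 + c) / 2 * numerical_radius T + (1 - c) / 2 * numerical_radius T"
      using ub[of t] calculation(1,2) by (intro add_mono mult_left_mono) (auto simp: c_def)
    moreover have "(1 + c) / 2 * numerical_radius T + (1 - c) / 2 * numerical_radius T = numerical_radius T"
      by (simp add: field_simps)
    ultimately show "\<bar>T u t\<bar> \<le> numerical_radius T + e" by linarith
  qed
  have "0 \<le> numerical_radius T" using unit[of 0 undefined] by simp
  then show ?thesis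
  proof (rule norm_blinfun_bound)
    fix u :: "'k \<Rightarrow>\<^sub>C real"
    have "norm (T (u /\<^sub>R norm u)) \<le> numerical_radius T"
      by (rule norm_bcontfun_le, rule unit) (cases "u = 0"; simp)
    then have "norm (T u) \<le> numerical_radius T * norm u" if "u \<noteq> 0"
      using that by (simp add: blinfun.scaleR_right divide_simps mult.commute)
    then show "norm (T u) \<le> numerical_radius T * norm u" by (cases "u = 0") auto
  qed
qed

text \<open>Since \<open>2 \<bar>s\<bar> + (1 - s\<^sup>2) \<le> 2\<close> for \<open>\<bar>s\<bar> \<le> 1\<close>, the functions \<open>2 x \<plusminus> (1 - x\<^sup>2) u\<close> have norm
  at most 2 when \<open>u\<close> is in the unit ball.\<close>

lemma abs_functional_defect_le:
  fixes f :: "('k::topological_space \<Rightarrow>\<^sub>C real) \<Rightarrow>\<^sub>L real" and x u :: "'k \<Rightarrow>\<^sub>C real"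
  assumes f: "norm f \<le> 1" and x: "norm x \<le> 1"
  shows "\<bar>f ((1 - x * x) * u)\<bar> \<le> 2 * (1 - f x) * norm u"
proof -
  let ?c = "norm u"
  have bound: "f v \<le> norm v" for v
  proof -
    have "norm (f v) \<le> norm f * norm v" by (rule norm_blinfun)
    also have "\<dots> \<le> norm v" using f by (simp add: mult_left_le_one_le)
    finally show ?thesis by simp
  qed
  have "\<bar>2 * ?c * x t\<bar> + \<bar>(1 - x t * x t) * u t\<bar> \<le> 2 * ?c" for t
  proof -
    have xt: "\<bar>x t\<bar> \<le> 1" using abs_bcontfun_le_norm[of x t] x by simp
    then have "x t * x t \<le> 1" by (metis abs_mult_self_eq abs_ge_zero mult_le_one)
    then have "\<bar>(1 - x t * x t) * u t\<bar> \<le> (1 - x t * x t) * ?c"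
      by (simp add: abs_mult mult_left_mono abs_bcontfun_le_norm)
    moreover have "0 \<le> (1 - \<bar>x t\<bar>) * (1 - \<bar>x t\<bar>) * ?c" by simp
    moreover have "(1 - \<bar>x t\<bar>) * (1 - \<bar>x t\<bar>) * ?c = ?c - 2 * ?c * \<bar>x t\<bar> + x t * x t * ?c"
      by (simp add: algebra_simps)
    ultimately show ?thesis by (simp add: abs_mult algebra_simps)
  qed
  then have "norm ((2 * ?c) *\<^sub>R x + (1 - x * x) * u) \<le> 2 * ?c"
    "norm ((2 * ?c) *\<^sub>R x - (1 - x * x) * u) \<le> 2 * ?c"
    by (auto intro!: norm_bcontfun_le simp: abs_le_iff) (smt (verit))+
  with bound have "f ((2 * ?c) *\<^sub>R x + (1 - x * x) * u) \<le> 2 * ?c"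
    "f ((2 * ?c) *\<^sub>R x - (1 - x * x) * u) \<le> 2 * ?c"
    by (meson order_trans)+
  then show ?thesis
    by (simp add: blinfun.add_right blinfun.diff_right blinfun.scaleR_right algebra_simps abs_le_iff)
qed

text \<open>Multiply by a cutoff \<open>g\<close> that is 1 where \<open>r \<ge> 1 - d\<close> and 0
  where \<open>r \<le> 1 - 2 * d\<close>, then renormalise. The functional
  \<open>u \<mapsto> f (x * u)\<close> is positive with value 1 at the unit and gives
  \<open>r\<close> a value of at least 1 - \<delta>, so a Markov inequality bounds the lost mass by
  \<delta>/d. The last conclusion will be applied to the modified function.\<close>

lemma functional_perturbation:
  fixes x r :: "'k::metric_space \<Rightarrow>\<^sub>C real"
  assumes cpt: "compact (UNIV :: 'k set)" and state: "(x, f) \<in> state_pairs"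
    and r: "\<And>t. r t \<le> 1" and fr: "1 - \<delta> \<le> f (x * r)" and d: "0 < d" "\<delta> < d"
  obtains f\<^sub>0 :: "('k \<Rightarrow>\<^sub>C real) \<Rightarrow>\<^sub>L real" where "norm f\<^sub>0 \<le> 1" "norm (f - f\<^sub>0) \<le> 2 * \<delta> / d"
    "\<And>u v. (\<And>t. 1 - 2 * d < r t \<Longrightarrow> apply_bcontfun u t = apply_bcontfun v t) \<Longrightarrow> f\<^sub>0 u = f\<^sub>0 v"
    "\<And>u. (\<And>t. \<bar>1 - x t * apply_bcontfun u t\<bar> \<le> 1 - x t * x t) \<Longrightarrow> f\<^sub>0 u = 1"
proof -
  have x: "norm x = 1" and f: "norm f = 1" and fx: "f x = 1"
    using state by (auto simp: state_pairs_def)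
  have xb: "\<bar>x t\<bar> \<le> 1" for t using abs_bcontfun_le_norm[of x t] x by simp
  have fb: "f v \<le> norm v" for v using norm_blinfun[of f v] f by simp
  \<comment> \<open>A functional of norm at most 1 with value 1 at the unit is positive.\<close>
  have pos: "0 \<le> f (x * u)" if "\<And>t. 0 \<le> apply_bcontfun u t" for u :: "'k \<Rightarrow>\<^sub>C real"
  proof -
    have "norm (x * (norm u *\<^sub>R 1 - u)) \<le> norm u"
    proof (rule norm_bcontfun_le)
      fix t
      have "\<bar>x t\<bar> * \<bar>norm u - u t\<bar> \<le> 1 * norm u"
        using that[of t] abs_bcontfun_le_norm[of u t] by (intro mult_mono xb) auto
      then show "\<bar>(x * (norm u *\<^sub>R 1 - u)) t\<bar> \<le> norm u" by (simp add: abs_mult)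
    qed
    then have "f (x * (norm u *\<^sub>R 1 - u)) \<le> norm u" using fb order_trans by blast
    then show ?thesis by (simp add: right_diff_distrib blinfun.diff_right blinfun.scaleR_right fx)
  qed
  have defect: "f ((1 - x * x) * u) = 0" for u
    using abs_functional_defect_le[of f x u] x f fx by simp
  have xx: "f (x * (x * u)) = f u" for u
    using defect[of u] by (simp add: left_diff_distrib blinfun.diff_right mult.assoc)
  \<comment> \<open>Positivity is applied to \<open>g\<close> times
    \<open>norm u \<plusminus> x * u\<close>; the surplus factor \<open>x * x\<close> acts as 1
    under \<open>f\<close>.\<close>
  have density: "\<bar>f (g * u)\<bar> \<le> f (x * g) * norm u" if g: "\<And>t. 0 \<le> apply_bcontfun g t" for g u :: "'k \<Rightarrow>\<^sub>C real"
  proof -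
    have xu: "\<bar>x t * u t\<bar> \<le> norm u" for t
      using mult_mono[OF xb[of t] abs_bcontfun_le_norm[of u t]] by (simp add: abs_mult)
    have comm: "g * (x * u) = x * (g * u)" by (rule bcontfun_eqI) simp
    have "0 \<le> f (x * (g * (norm u *\<^sub>R 1 + x * u)))" "0 \<le> f (x * (g * (norm u *\<^sub>R 1 - x * u)))"
      using g xu by (auto intro!: pos mult_nonneg_nonneg simp: abs_le_iff) (smt (verit))+
    then show ?thesis
      by (simp add: ring_distribs blinfun.add_right blinfun.diff_right blinfun.scaleR_right
          comm xx abs_le_iff mult.commute)
  qed
  define g where "g = Bcontfun (\<lambda>t. max 0 (min 1 ((r t - (1 - 2 * d)) / d)))"
  have g: "g t = max 0 (min 1 ((r t - (1 - 2 * d)) / d))" for t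
    unfolding g_def using d(1)
    by (subst bcontfun_of_continuous[OF cpt]) (auto intro!: continuous_intros)
  have gb: "0 \<le> g t" "0 \<le> (1 - g) t" for t by (auto simp: g)
  define P where "P = f (x * g)"
  have P1: "f (x * (1 - g)) = 1 - P"
    by (simp add: P_def right_diff_distrib blinfun.diff_right fx)
  have P_le: "1 - P \<le> \<delta> / d"
  proof -
    \<comment> \<open>Markov's inequality in pointwise form:
      \<open>1 - g \<le> (1 - r) / d\<close>.\<close>
    have "0 \<le> ((1 / d) *\<^sub>R (1 - r) - (1 - g)) t" for t
    proof -
      define z where "z = (1 - r t) / d"
      have "0 \<le> z" "(r t - (1 - 2 * d)) / d = 2 - z"
        using d(1) r[of t] by (simp_all add: z_def field_simps)
      then show ?thesis by (auto simp: g z_def)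
    qed
    then have "0 \<le> f (x * ((1 / d) *\<^sub>R (1 - r) - (1 - g)))" by (rule pos)
    moreover have "f (x * (1 - r)) \<le> \<delta>"
      using fr by (simp add: right_diff_distrib blinfun.diff_right fx)
    then have "f (x * (1 - r)) / d \<le> \<delta> / d" using d(1) by (simp add: divide_right_mono)
    ultimately show ?thesis
      using P1 by (simp add: right_diff_distrib[of x "_ *\<^sub>R _"] blinfun.diff_right blinfun.scaleR_right)
  qed
  have "0 \<le> 1 - P" using pos[of "1 - g", OF gb(2)] P1 by simp
  have "\<delta> / d < 1" using d by simp
  with P_le have "0 < P" by linarith
  define f0 where "f0 = (1 / P) *\<^sub>R (f o\<^sub>L blinfun_mult_right g)"
  have f0: "f0 u = f (g * u) / P" for u
    by (simp add: f0_def blinfun.scaleR_left blinfun_mult_right.rep_eq)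
  show ?thesis
  proof (rule that[of f0])
    show "norm f0 \<le> 1"
      by (rule norm_blinfun_bound)
        (use density[OF gb(1)] \<open>0 < P\<close> in \<open>auto simp: f0 P_def divide_simps mult.commute\<close>)
    show "norm (f - f0) \<le> 2 * \<delta> / d"
    proof (rule norm_blinfun_bound)
      fix u
      have "f u = f ((1 - g) * u) + f (g * u)"
        by (simp add: left_diff_distrib blinfun.diff_right)
      then have "(f - f0) u = f ((1 - g) * u) + f (g * u) * (1 - 1 / P)"
        by (simp add: blinfun.diff_left f0 right_diff_distrib)
      also have "\<bar>\<dots>\<bar> \<le> \<bar>f ((1 - g) * u)\<bar> + \<bar>f (g * u)\<bar> * \<bar>1 - 1 / P\<bar>"
        by (metis abs_mult abs_triangle_ineq)
      \<comment> \<open>One term \<open>1 - P\<close> comes from cutting off, the other from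
        renormalising.\<close>
      also have "\<dots> \<le> (1 - P) * norm u + (P * norm u) * (1 / P - 1)"
      proof (intro add_mono mult_mono)
        show "\<bar>f ((1 - g) * u)\<bar> \<le> (1 - P) * norm u" using density[OF gb(2)] P1 by simp
        show "\<bar>f (g * u)\<bar> \<le> P * norm u" using density[OF gb(1)] P_def by simp
        show "\<bar>1 - 1 / P\<bar> \<le> 1 / P - 1" using \<open>0 < P\<close> \<open>0 \<le> 1 - P\<close> by (simp add: divide_simps)
      qed (use \<open>0 < P\<close> in auto)
      also have "\<dots> = 2 * (1 - P) * norm u" using \<open>0 < P\<close> by (simp add: field_simps)
      also have "\<dots> \<le> 2 * (\<delta> / d) * norm u" using P_le by (intro mult_right_mono) auto
      finally show "norm ((f - f0) u) \<le> 2 * \<delta> / d * norm u" by simp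
    next
      have "0 \<le> \<delta> / d" using P_le \<open>0 \<le> 1 - P\<close> by linarith
      then show "0 \<le> 2 * \<delta> / d" by simp
    qed
    show "f0 u = f0 v" if "\<And>t. 1 - 2 * d < r t \<Longrightarrow> apply_bcontfun u t = apply_bcontfun v t" for u v :: "'k \<Rightarrow>\<^sub>C real"
    proof -
      have "g t * u t = g t * v t" for t
        using that[of t] d(1) by (cases "1 - 2 * d < r t") (auto simp: g divide_nonpos_pos)
      then have "g * u = g * v" by (intro bcontfun_eqI) simp
      then show ?thesis by (simp add: f0)
    qed
    show "f0 u = 1" if u: "\<And>t. \<bar>1 - x t * apply_bcontfun u t\<bar> \<le> 1 - x t * x t" for u :: "'k \<Rightarrow>\<^sub>C real"
    proof -
      \<comment> \<open>The function \<open>1 - x * u\<close> lies between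
        \<open>\<plusminus>(1 - x * x)\<close>, and \<open>f\<close> vanishes on multiples of the
        latter.\<close>
      have "0 \<le> f (x * (g * ((1 - x * x) + (1 - x * u))))" "0 \<le> f (x * (g * ((1 - x * x) - (1 - x * u))))"
        using u gb(1) by (auto intro!: pos mult_nonneg_nonneg simp: abs_le_iff) (smt (verit))+
      moreover have "f (x * (g * (1 - x * x))) = 0"
      proof -
        have "x * (g * (1 - x * x)) = (1 - x * x) * (x * g)" by (rule bcontfun_eqI) simp
        then show ?thesis by (simp add: defect)
      qed
      ultimately have "f (x * (g * (1 - x * u))) = 0"
        by (simp only: distrib_left right_diff_distrib[of g "1 - x * x"] right_diff_distrib[of x "g * (1 - x * x)"]
            blinfun.add_right blinfun.diff_right)
      moreover have "x * (g * (1 - x * u)) = x * g - x * (x * (g * u))"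
        by (rule bcontfun_eqI) (simp add: algebra_simps)
      ultimately have "f (g * u) = P" by (simp add: blinfun.diff_right xx P_def)
      then show ?thesis using \<open>0 < P\<close> by (simp add: f0)
    qed
  qed
qed

section \<open>Perturbing the operator\<close>

text \<open>The arithmetic of \<open>operator_perturbation\<close> at one point, with
  \<open>c\<close> the norm of the argument. It telescopes through \<open>U\<close>,
  \<open>y\<close>, \<open>z * x * y\<close>, \<open>z * B\<close>, \<open>z * A\<close>,
  \<open>z * A / s\<close>, where \<open>z\<close> is the value of the modified function and
  \<open>s\<close> the normalising mass.\<close>

lemma perturbation_estimate:
  fixes U y B A s x z c \<eta> :: real
  assumes \<eta>: "0 < \<eta>" "\<eta> \<le> 1 / 4" and c: "0 \<le> c"
    and U: "\<bar>U - y\<bar> \<le> 12 * (\<eta>\<^sup>2 / 64) * (1 + 1 / \<eta>) * c" and y: "\<bar>y\<bar> \<le> c"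
    and zx: "\<bar>1 - z * x\<bar> \<le> 3 * (\<eta>\<^sup>2 / 64)" and z: "\<bar>z\<bar> \<le> 1"
    and B: "\<bar>x * y - B\<bar> \<le> 6 * (\<eta>\<^sup>2 / 64) * c" and A: "\<bar>B - A\<bar> \<le> \<eta> * c" "\<bar>A\<bar> \<le> s * c"
    and s: "0 < s" "s \<le> 1" "1 - s \<le> 12 * (\<eta>\<^sup>2 / 64) / \<eta>"
  shows "\<bar>U - z * A / s\<bar> \<le> 2 * \<eta> * c"
proof -
  have "\<bar>(1 - z * x) * y\<bar> \<le> 3 * (\<eta>\<^sup>2 / 64) * c"
    unfolding abs_mult using zx y by (intro mult_mono) auto
  moreover have "\<bar>z * (x * y - B)\<bar> \<le> 1 * (6 * (\<eta>\<^sup>2 / 64) * c)"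
    unfolding abs_mult using z B by (intro mult_mono) auto
  moreover have "\<bar>z * (B - A)\<bar> \<le> 1 * (\<eta> * c)"
    unfolding abs_mult using z A by (intro mult_mono) auto
  moreover have "\<bar>z * (A - A / s)\<bar> \<le> 1 * (12 * (\<eta>\<^sup>2 / 64) / \<eta> * c)"
    unfolding abs_mult
  proof (intro mult_mono z)
    have "\<bar>A - A / s\<bar> = \<bar>A\<bar> / s * (1 - s)"
    proof -
      have "A - A / s = - (A / s * (1 - s))" using s by (simp add: field_simps)
      then show ?thesis using s by (simp add: abs_mult)
    qed
    also have "\<dots> \<le> c * (1 - s)"
      using A(2) s by (intro mult_right_mono) (auto simp: divide_simps mult.commute)
    also have "\<dots> \<le> c * (12 * (\<eta>\<^sup>2 / 64) / \<eta>)" using s c by (intro mult_left_mono) auto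
    finally show "\<bar>A - A / s\<bar> \<le> 12 * (\<eta>\<^sup>2 / 64) / \<eta> * c" by (simp add: mult.commute)
  qed auto
  moreover have "U - z * A / s = (U - y) + (1 - z * x) * y + z * (x * y - B) + z * (B - A) + z * (A - A / s)"
    by (simp add: algebra_simps)
  ultimately have "\<bar>U - z * A / s\<bar> \<le> 12 * (\<eta>\<^sup>2 / 64) * (1 + 1 / \<eta>) * c + 3 * (\<eta>\<^sup>2 / 64) * c
      + 6 * (\<eta>\<^sup>2 / 64) * c + \<eta> * c + 12 * (\<eta>\<^sup>2 / 64) / \<eta> * c"
    using U by linarith
  also have "\<dots> = (21 * \<eta> + 88) / 64 * \<eta> * c"
    using \<eta> by (simp add: field_simps power2_eq_square)
  also have "\<dots> \<le> 2 * \<eta> * c"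
    using \<eta> c by (intro mult_right_mono) auto
  finally show ?thesis .
qed

text \<open>On the set where \<open>x * T x\<close> is close to 1, conjugating \<open>T\<close> by \<open>x\<close> gives an operator
  close to a positive one; the weight \<open>k\<close> concentrates the latter on the set where \<open>\<bar>x\<^sub>0\<bar> = 1\<close>.\<close>

lemma operator_perturbation:
  fixes T :: "('k::metric_space \<Rightarrow>\<^sub>C real) \<Rightarrow>\<^sub>L ('k \<Rightarrow>\<^sub>C real)" and x :: "'k \<Rightarrow>\<^sub>C real"
  assumes cpt: "compact (UNIV :: 'k set)" and T: "norm T \<le> 1" and x: "norm x \<le> 1"
    and \<eta>: "0 < \<eta>" "\<eta> \<le> 1 / 4"
  obtains T\<^sub>0 :: "('k \<Rightarrow>\<^sub>C real) \<Rightarrow>\<^sub>L ('k \<Rightarrow>\<^sub>C real)" and x\<^sub>0 :: "'k::metric_space \<Rightarrow>\<^sub>C real"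
  where "norm T\<^sub>0 \<le> 1" "norm (T - T\<^sub>0) \<le> 2 * \<eta>" "norm x\<^sub>0 \<le> 1" "norm (x - x\<^sub>0) \<le> \<eta>"
    "\<And>t. \<bar>1 - x t * x\<^sub>0 t\<bar> \<le> 1 - x t * x t"
    "\<And>t. 1 - 2 * (\<eta>\<^sup>2 / 64) < x t * T x t \<Longrightarrow> T\<^sub>0 x\<^sub>0 t = x\<^sub>0 t"
proof -
  \<comment> \<open>Errors of order d/\<eta> occur below, so \<open>d\<close> is quadratic in
    \<eta>.\<close>
  define d where "d = \<eta>\<^sup>2 / 64"
  have d: "0 < d" "d \<le> \<eta> / 256"
    using \<eta> by (auto simp: d_def power2_eq_square)
  have xb: "\<bar>x t\<bar> \<le> 1" for t using abs_bcontfun_le_norm[of x t] x by simp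
  have xxb: "x t * x t \<le> \<bar>x t\<bar>" for t
    using mult_left_le_one_le[of "\<bar>x t\<bar>" "\<bar>x t\<bar>"] xb[of t] by simp
  have Tb: "\<bar>T u t\<bar> \<le> norm u" for u t
    using abs_blinfun_bcontfun_le[of u "norm u" T t] mult_right_mono[OF T, of "norm u"] by simp
  define r where "r = x * T x"
  have r: "r t = x t * T x t" for t by (simp add: r_def)
  have r1: "r t \<le> 1" for t
    using mult_mono[OF xb[of t], of "\<bar>T x t\<bar>" 1] Tb[of x t] x by (simp add: r flip: abs_mult)
  have rx: "r t \<le> \<bar>x t\<bar>" for t
    using mult_left_le[of "\<bar>T x t\<bar>" "\<bar>x t\<bar>"] Tb[of x t] x by (simp add: r flip: abs_mult)
  define e where "e = 1 - x * x"
  have e: "e t = 1 - x t * x t" for t by (simp add: e_def)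
  have eb: "0 \<le> e t" "e t \<le> 1" for t using xxb[of t] xb[of t] by (auto simp: e)
  \<comment> \<open>The functional \<open>u \<mapsto> x t * T u t\<close> has norm at most 1 and
    value \<open>r t\<close> at \<open>x\<close>, so it is small on multiples of \<open>e\<close>
    where \<open>r t\<close> is near 1.\<close>
  have defect: "\<bar>x t * T (e * u) t\<bar> \<le> 2 * (1 - r t) * norm u" for u t
  proof -
    define F where "F = x t *\<^sub>R (eval_at t o\<^sub>L T)"
    have F: "F u = x t * T u t" for u by (simp add: F_def blinfun.scaleR_left)
    have "norm F \<le> 1"
    proof (rule norm_blinfun_bound)
      fix u show "norm (F u) \<le> 1 * norm u"
        unfolding F real_norm_def abs_mult by (intro mult_mono xb Tb) auto
    qed simp
    from abs_functional_defect_le[OF this x, of u] show ?thesis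
      by (simp only: F e_def r)
  qed

  define R where "R = blinfun_mult_right x o\<^sub>L T o\<^sub>L blinfun_mult_right x"
  have R: "R u t = x t * T (x * u) t" for u t by (simp add: R_def)
  have "norm R \<le> 1"
  proof (rule norm_blinfun_bound)
    fix u
    show "norm (R u) \<le> 1 * norm u"
    proof (rule norm_bcontfun_le)
      fix t
      have "norm (x * u) \<le> 1 * norm u"
        by (rule order_trans[OF norm_mult_ineq]) (intro mult_right_mono x norm_ge_zero)
      then show "\<bar>R u t\<bar> \<le> 1 * norm u"
        unfolding R abs_mult using Tb[of "x * u" t] by (intro mult_mono xb) auto
    qed
  qed simp
  obtain S :: "('k \<Rightarrow>\<^sub>C real) \<Rightarrow>\<^sub>L ('k \<Rightarrow>\<^sub>C real)" where S1: "S 1 = 1"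
    and S_pos: "\<And>f t. (\<And>y. 0 \<le> apply_bcontfun f y) \<Longrightarrow> 0 \<le> S f t"
    and S_R: "\<And>f t. \<bar>S f t - R f t\<bar> \<le> (\<bar>1 - R 1 t\<bar> + norm R - \<bar>R 1 t\<bar>) * norm f"
    using positive_approximation[OF cpt, of R] by blast
  have S_close: "\<bar>S u t - R u t\<bar> \<le> 6 * d * norm u" if "1 - 3 * d < r t" for u t
  proof -
    have "R 1 t = r t" by (simp add: R r)
    then have "\<bar>1 - R 1 t\<bar> + norm R - \<bar>R 1 t\<bar> \<le> 6 * d"
      using that r1[of t] \<open>norm R \<le> 1\<close> d \<eta> by simp
    then show ?thesis by (rule order_trans[OF S_R mult_right_mono[OF _ norm_ge_zero]])
  qed
  have S_weight: "\<bar>S (v * u) t\<bar> \<le> S v t * norm u" if "\<And>y. 0 \<le> apply_bcontfun v y" for u v t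
  proof -
    have "0 \<le> norm u + apply_bcontfun u y" "0 \<le> norm u - apply_bcontfun u y" for y
      using abs_bcontfun_le_norm[of u y] by auto
    then have "0 \<le> S (v * (norm u *\<^sub>R 1 + u)) t" "0 \<le> S (v * (norm u *\<^sub>R 1 - u)) t"
      using that by (auto intro!: S_pos mult_nonneg_nonneg)
    then show ?thesis
      by (simp add: ring_distribs blinfun.add_right blinfun.diff_right blinfun.scaleR_right
          abs_le_iff mult.commute)
  qed
  have Sb: "\<bar>S u t\<bar> \<le> norm u" for u t
    using S_weight[of 1 u t] S1 by simp

  \<comment> \<open>Gluing function: 1 where \<open>r \<ge> 1 - 2 * d\<close> and 0 where
    \<open>r \<le> 1 - 3 * d\<close>.\<close>
  define h where "h = Bcontfun (\<lambda>t. max 0 (min 1 ((r t - (1 - 3 * d)) / d)))"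
  have h: "h t = max 0 (min 1 ((r t - (1 - 3 * d)) / d))" for t
    unfolding h_def using d
    by (subst bcontfun_of_continuous[OF cpt]) (auto intro!: continuous_intros)
  have hb: "0 \<le> h t" "h t \<le> 1" for t by (auto simp: h)
  have h0: "1 - 3 * d < r t" if "h t \<noteq> 0" for t
    using that d(1) by (cases "1 - 3 * d < r t") (auto simp: h divide_nonpos_pos)
  \<comment> \<open>A continuous modification of \<open>x\<close> that equals its sign wherever |x|
    >= 1 - \<eta>.\<close>
  define x0 where "x0 = Bcontfun (\<lambda>t. x t / max (1 - \<eta>) \<bar>x t\<bar>)"
  have x0: "x0 t = x t / max (1 - \<eta>) \<bar>x t\<bar>" for t
    unfolding x0_def using \<eta>
    by (subst bcontfun_of_continuous[OF cpt]) (auto intro!: continuous_intros)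
  have x0_sgn: "x0 t = sgn (x t)" if "1 - \<eta> \<le> \<bar>x t\<bar>" for t
    using that \<eta> by (simp add: x0 max_def sgn_real_def)
  have x0b: "\<bar>x0 t\<bar> \<le> 1" for t
    using \<eta> by (simp add: x0 divide_le_eq)
  have x0_close: "\<bar>x t - x0 t\<bar> \<le> \<eta>" for t
  proof (cases "1 - \<eta> \<le> \<bar>x t\<bar>")
    case True
    then show ?thesis using x0_sgn[of t] xb[of t] by (auto simp: sgn_real_def abs_if split: if_splits)
  next
    case False
    then have "x t - x0 t = - (\<eta> * (x t / (1 - \<eta>)))"
      using \<eta> by (simp add: x0 field_simps)
    also have "\<bar>\<dots>\<bar> \<le> \<eta> * 1"
      unfolding abs_minus_cancel abs_mult using False \<eta> by (intro mult_mono) (auto simp: divide_simps)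
    finally show ?thesis by simp
  qed
  have xx0: "\<bar>1 - x t * x0 t\<bar> \<le> 1 - x t * x t" for t
  proof -
    have m: "max (1 - \<eta>) \<bar>x t\<bar> \<le> 1" "0 < max (1 - \<eta>) \<bar>x t\<bar>" using xb[of t] \<eta> by auto
    have "x t * x t \<le> x t * x t / max (1 - \<eta>) \<bar>x t\<bar>"
      using m by (simp add: le_divide_eq mult_left_le)
    moreover have "x t * x t / max (1 - \<eta>) \<bar>x t\<bar> \<le> 1"
      using m xxb[of t] by (simp add: divide_le_eq)
    ultimately show ?thesis by (simp add: x0)
  qed

  \<comment> \<open>The weight \<open>k\<close> vanishes unless e < \<eta>, which forces |x0| = 1.
    Its complement is the multiple \<open>e * q\<close> of \<open>e\<close>, so that
    \<open>defect\<close> controls the effect of inserting \<open>k\<close>.\<close>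
  define q where "q = Bcontfun (\<lambda>t. 1 / max \<eta> (e t))"
  have q: "q t = 1 / max \<eta> (e t)" for t
    unfolding q_def using \<eta>
    by (subst bcontfun_of_continuous[OF cpt]) (auto intro!: continuous_intros)
  have qb: "0 \<le> q t" "q t \<le> 1 / \<eta>" for t
    using \<eta> by (auto simp: q intro!: divide_left_mono)
  define k where "k = 1 - e * q"
  have k: "k t = 1 - e t / max \<eta> (e t)" for t by (simp add: k_def q)
  have kb: "0 \<le> k t" "k t \<le> 1" for t
    using \<eta> eb[of t] by (auto simp: k divide_le_eq)
  have k_x0: "k * (x0 * x0) = k"
  proof (rule bcontfun_eqI)
    fix t
    show "(k * (x0 * x0)) t = k t"
    proof (cases "k t = 0")
      case False
      then have "e t < \<eta>" using \<eta> by (auto simp: k max_def split: if_splits)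
      then have "1 - \<eta> \<le> \<bar>x t\<bar>" using xxb[of t] by (simp add: e)
      then have "x0 t * x0 t = 1" using x0_sgn[of t] \<eta> by (auto simp: sgn_real_def)
      then show ?thesis by simp
    qed simp
  qed
  define s where "s = S k"
  have s_le: "s t \<le> 1" for t
    using S_pos[of "1 - k" t] kb by (simp add: s_def blinfun.diff_right S1)
  have s_nonneg: "0 \<le> s t" for t
    using S_pos[of k t] kb by (simp add: s_def)
  \<comment> \<open>The missing mass is \<open>S (e * q) t\<close>, at most
    \<open>S e t / \<eta>\<close>; closeness of \<open>S\<close> to \<open>R\<close> and
    \<open>defect\<close> contribute \<open>6 * d\<close> each to \<open>S e t\<close>.\<close>
  have s_ge: "1 - s t \<le> 12 * d / \<eta>" if "1 - 3 * d < r t" for t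
  proof -
    have "norm e \<le> 1" using eb by (intro norm_bcontfun_le) (simp add: abs_le_iff)
    have "S e t \<le> R e t + 6 * d"
      using S_close[OF that, of e] mult_left_mono[OF \<open>norm e \<le> 1\<close>, of "6 * d"] d by linarith
    moreover have "R e t \<le> 6 * d"
    proof -
      have "R e t = x t * T (e * x) t" by (simp add: R mult.commute e_def algebra_simps)
      also have "\<dots> \<le> 2 * (1 - r t) * norm x" using defect[of t x] by linarith
      also have "\<dots> \<le> 2 * (1 - r t) * 1" using x r1[of t] by (intro mult_left_mono) auto
      finally show ?thesis using that by (simp add: algebra_simps)
    qed
    ultimately have "S e t / \<eta> \<le> 12 * d / \<eta>" using \<eta> by (intro divide_right_mono) auto
    moreover have "0 \<le> S ((1 / \<eta>) *\<^sub>R e - e * q) t"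
      using mult_left_mono[OF qb(2) eb(1)] by (intro S_pos) simp
    ultimately show ?thesis
      by (simp add: s_def k_def blinfun.diff_right blinfun.scaleR_right S1)
  qed
  have s_half: "1 / 2 \<le> s t" if "1 - 3 * d < r t" for t
  proof -
    have "12 * d / \<eta> \<le> 12 * (\<eta> / 256) / \<eta>" using d \<eta> by (intro divide_right_mono) auto
    then show ?thesis using s_ge[OF that] \<eta> by simp
  qed

  \<comment> \<open>The lower bound 1/2 only keeps the quotient continuous: wherever
    \<open>h\<close> is nonzero, \<open>s\<close> is at least 1/2 by \<open>s_half\<close>.\<close>
  define v where "v = Bcontfun (\<lambda>t. h t * x0 t / max (s t) (1 / 2))"
  have v: "v t = h t * x0 t / max (s t) (1 / 2)" for t
  proof -
    have "max (s t) (1 / 2) \<noteq> 0" for t by linarith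
    then have "continuous_on UNIV (\<lambda>t. h t * x0 t / max (s t) (1 / 2))"
      by (intro continuous_intros continuous_on_apply_bcontfun) auto
    then show ?thesis by (simp add: v_def bcontfun_of_continuous[OF cpt])
  qed
  \<comment> \<open>With weights \<open>h\<close> and \<open>1 - h\<close>, this mixes the map
    sending \<open>u\<close> to \<open>x0 * S (k * x0 * u) / s\<close> with \<open>T\<close>. The
    former fixes \<open>x0\<close> where \<open>h = 1\<close>, since \<open>k * x0 * x0 = k\<close>
    and \<open>s = S k\<close>.\<close>
  define T0 where "T0 = (blinfun_mult_right v o\<^sub>L S o\<^sub>L blinfun_mult_right (k * x0))
      + (blinfun_mult_right (1 - h) o\<^sub>L T)"
  have T0: "T0 u t = v t * S (k * (x0 * u)) t + (1 - h t) * T u t" for u t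
    by (simp add: T0_def blinfun.add_left mult.assoc)
  have norm_x0u: "norm (x0 * u) \<le> norm u" for u
    using norm_mult_ineq[of x0 u] mult_right_mono[OF norm_bcontfun_le[OF x0b] norm_ge_zero[of u]]
    by simp
  have A: "\<bar>S (k * (x0 * u)) t\<bar> \<le> s t * norm u" for u t
    using S_weight[of k "x0 * u" t] kb mult_left_mono[OF norm_x0u[of u] s_nonneg[of t]]
    by (simp add: s_def)
  show ?thesis
  proof (rule that[of T0 x0])
    show "norm T0 \<le> 1"
    proof (rule norm_blinfun_bound)
      fix u
      show "norm (T0 u) \<le> 1 * norm u"
      proof (rule norm_bcontfun_le)
        fix t
        have "\<bar>v t * S (k * (x0 * u)) t\<bar> \<le> (h t / max (s t) (1 / 2)) * (s t * norm u)"
          unfolding abs_mult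
        proof (intro mult_mono A)
          have "h t * \<bar>x0 t\<bar> \<le> h t * 1" by (intro mult_left_mono x0b hb)
          then show "\<bar>v t\<bar> \<le> h t / max (s t) (1 / 2)"
            using hb[of t] by (simp add: v abs_mult divide_right_mono)
        qed (use hb[of t] in auto)
        also have "\<dots> = (s t / max (s t) (1 / 2)) * (h t * norm u)" by simp
        also have "\<dots> \<le> 1 * (h t * norm u)"
          using hb[of t] by (intro mult_right_mono) (auto simp: divide_le_eq)
        finally have "\<bar>v t * S (k * (x0 * u)) t\<bar> \<le> h t * norm u" by simp
        moreover have "\<bar>(1 - h t) * T u t\<bar> \<le> (1 - h t) * norm u"
          unfolding abs_mult using hb[of t] by (intro mult_mono Tb) auto
        ultimately show "\<bar>T0 u t\<bar> \<le> 1 * norm u" unfolding T0 by (simp add: algebra_simps)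
      qed
    qed simp
    show "norm (T - T0) \<le> 2 * \<eta>"
    proof (rule norm_blinfun_bound)
      fix u
      show "norm ((T - T0) u) \<le> 2 * \<eta> * norm u"
      proof (rule norm_bcontfun_le)
        fix t
        have diff: "(T - T0) u t = h t * T u t - v t * S (k * (x0 * u)) t"
          by (simp add: blinfun.diff_left T0 algebra_simps)
        show "\<bar>(T - T0) u t\<bar> \<le> 2 * \<eta> * norm u"
        proof (cases "h t = 0")
          case True
          then show ?thesis using \<eta> by (simp add: diff v)
        next
          case False
          then have rt: "1 - 3 * d < r t" by (rule h0)
          have xt: "1 - 3 * d < \<bar>x t\<bar>" using rt rx[of t] by linarith
          then have xt': "1 / 2 \<le> \<bar>x t\<bar>" "1 - \<eta> \<le> \<bar>x t\<bar>" using d \<eta> by linarith+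
          \<comment> \<open>Replacing \<open>u\<close> by \<open>x * k * x * u\<close> changes it by
            a multiple of \<open>e\<close>, and turns \<open>x t * y\<close> into \<open>R\<close>
            applied to \<open>k * x * u\<close>.\<close>
          define y where "y = T (x * (k * (x * u))) t"
          have ku: "norm (k * (x * u)) \<le> norm u"
          proof (rule norm_bcontfun_le)
            fix t
            have "\<bar>k t\<bar> * (\<bar>x t\<bar> * \<bar>u t\<bar>) \<le> 1 * (1 * norm u)"
              using kb[of t] by (intro mult_mono xb abs_bcontfun_le_norm) auto
            then show "\<bar>(k * (x * u)) t\<bar> \<le> norm u" by (simp add: abs_mult)
          qed
          have "\<bar>T u t - x0 t * S (k * (x0 * u)) t / s t\<bar> \<le> 2 * \<eta> * norm u"
          proof (rule perturbation_estimate[where y = y and x = "x t" and B = "S (k * (x * u)) t"])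
            let ?w = "(1 + x * x * q) * u"
            have "u - x * (k * (x * u)) = e * ?w"
              by (rule bcontfun_eqI) (simp add: k_def e algebra_simps)
            then have Ty: "T u t - y = T (e * ?w) t"
              unfolding y_def by (metis blinfun.diff_right minus_bcontfun.rep_eq)
            have "norm ?w \<le> (1 + 1 / \<eta>) * norm u"
            proof (rule norm_bcontfun_le)
              fix t
              have "x t * x t * q t \<le> 1 * (1 / \<eta>)"
                using qb[of t] xxb[of t] xb[of t] by (intro mult_mono) auto
              moreover have "0 \<le> x t * x t * q t" using qb(1)[of t] by simp
              ultimately show "\<bar>?w t\<bar> \<le> (1 + 1 / \<eta>) * norm u"
                by (simp only: apply_times_bcontfun plus_bcontfun.rep_eq apply_one_bcontfun abs_mult)
                  (intro mult_mono abs_bcontfun_le_norm; simp)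
            qed
            moreover have "2 * (1 - r t) \<le> 6 * d" using rt by (simp add: algebra_simps)
            ultimately have "2 * (1 - r t) * norm ?w \<le> (6 * d) * ((1 + 1 / \<eta>) * norm u)"
              using d by - (rule mult_mono, auto)
            then have "\<bar>x t\<bar> * \<bar>T (e * ?w) t\<bar> \<le> (6 * d) * ((1 + 1 / \<eta>) * norm u)"
              using defect[of t ?w] unfolding abs_mult by linarith
            \<comment> \<open>Removing the factor |x t| >= 1/2 turns the constant 6 into 12.\<close>
            moreover have "1 / 2 * \<bar>T (e * ?w) t\<bar> \<le> \<bar>x t\<bar> * \<bar>T (e * ?w) t\<bar>"
              using xt' by (intro mult_right_mono) auto
            ultimately show "\<bar>T u t - y\<bar> \<le> 12 * (\<eta>\<^sup>2 / 64) * (1 + 1 / \<eta>) * norm u"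
              unfolding Ty d_def by linarith
            have "norm (x * (k * (x * u))) \<le> norm u"
              using norm_mult_ineq[of x "k * (x * u)"] mult_mono[OF x ku] by simp
            then show "\<bar>y\<bar> \<le> norm u" unfolding y_def using Tb order_trans by blast
            have "x0 t * x t = \<bar>x t\<bar>" using x0_sgn[OF xt'(2)] by (simp add: abs_sgn mult.commute)
            then show "\<bar>1 - x0 t * x t\<bar> \<le> 3 * (\<eta>\<^sup>2 / 64)"
              using xt xb[of t] by (simp add: d_def)
            show "\<bar>x t * y - S (k * (x * u)) t\<bar> \<le> 6 * (\<eta>\<^sup>2 / 64) * norm u"
              using S_close[OF rt, of "k * (x * u)"] mult_left_mono[OF ku, of "6 * d"] d
              unfolding R y_def d_def[symmetric] by linarith
            have "norm (k * ((x - x0) * u)) \<le> \<eta> * norm u"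
            proof (rule norm_bcontfun_le)
              fix t
              have "\<bar>k t\<bar> * (\<bar>x t - x0 t\<bar> * \<bar>u t\<bar>) \<le> 1 * (\<eta> * norm u)"
                using kb[of t] \<eta> by (intro mult_mono x0_close abs_bcontfun_le_norm) auto
              then show "\<bar>(k * ((x - x0) * u)) t\<bar> \<le> \<eta> * norm u" by (simp add: abs_mult)
            qed
            then have "\<bar>S (k * ((x - x0) * u)) t\<bar> \<le> \<eta> * norm u" using Sb order_trans by blast
            then show "\<bar>S (k * (x * u)) t - S (k * (x0 * u)) t\<bar> \<le> \<eta> * norm u"
              by (simp add: left_diff_distrib right_diff_distrib blinfun.diff_right)
            show "0 < s t" using s_half[OF rt] by simp
            show "1 - s t \<le> 12 * (\<eta>\<^sup>2 / 64) / \<eta>" using s_ge[OF rt] by (simp add: d_def)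
          qed (use \<eta> x0b A s_le in auto)
          then have "h t * \<bar>T u t - x0 t * S (k * (x0 * u)) t / s t\<bar> \<le> 1 * (2 * \<eta> * norm u)"
            using hb[of t] by (intro mult_mono) auto
          moreover have "(T - T0) u t = h t * (T u t - x0 t * S (k * (x0 * u)) t / s t)"
            using s_half[OF rt] by (simp add: diff v right_diff_distrib max_absorb1)
          ultimately show ?thesis using hb[of t] by (simp add: abs_mult)
        qed
      qed
    qed (use \<eta> in simp)
    show "norm x0 \<le> 1" using x0b by (rule norm_bcontfun_le)
    show "norm (x - x0) \<le> \<eta>" using x0_close by (intro norm_bcontfun_le) simp
    show "\<bar>1 - x t * x0 t\<bar> \<le> 1 - x t * x t" for t by (rule xx0)
    show "T0 x0 t = x0 t" if "1 - 2 * (\<eta>\<^sup>2 / 64) < x t * T x t" for t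
    proof -
      have rt: "1 - 2 * d < r t" using that by (simp add: r d_def)
      then have "h t = 1" using d by (simp add: h min_def le_divide_eq)
      moreover have "1 / 2 \<le> s t" using rt d by (intro s_half) simp
      ultimately show ?thesis by (simp add: T0 k_x0 v max_def flip: s_def)
    qed
  qed
qed

section \<open>The Bishop-Phelps-Bollobas property\<close>

theorem corollary3p3:
  assumes "compact (UNIV :: 'k::metric_space set)"
  shows "BPB_numerical_radius TYPE('k \<Rightarrow>\<^sub>C real)"
  unfolding BPB_numerical_radius_def
\<comment> \<open>With \<eta> = \<epsilon>/4 and d = \<eta>^2/64 this is d \<epsilon>/4. The
  operator then moves by at most 2 \<eta> = \<epsilon>/2, the function by \<epsilon>/4 and the
  functional by 2 \<delta>/d = \<epsilon>/2.\<close>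
proof (intro exI[of _ "\<lambda>\<epsilon>. (\<epsilon> / 4)\<^sup>2 / 64 * \<epsilon> / 4"] conjI ballI allI impI)
  fix \<epsilon> :: real assume "\<epsilon> \<in> {0<..<1}"
  then have \<epsilon>: "0 < \<epsilon>" "\<epsilon> < 1" by auto
  have "\<epsilon>\<^sup>2 * \<epsilon> < 1" using \<epsilon> by (simp add: power_less_one_iff flip: power_Suc2)
  then show "(\<epsilon> / 4)\<^sup>2 / 64 * \<epsilon> / 4 \<in> {0<..<1}"
    using \<epsilon> by (simp add: power_divide)
next
  fix \<epsilon> :: real and T :: "('k \<Rightarrow>\<^sub>C real) \<Rightarrow>\<^sub>L ('k \<Rightarrow>\<^sub>C real)" and x f
  assume "\<epsilon> \<in> {0<..<1}" and radius: "numerical_radius T = 1" and state: "(x, f) \<in> state_pairs"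
    and fTx: "1 - (\<epsilon> / 4)\<^sup>2 / 64 * \<epsilon> / 4 \<le> f (T x)"
  then have \<epsilon>: "0 < \<epsilon>" "\<epsilon> < 1" by auto
  define d where "d = (\<epsilon> / 4)\<^sup>2 / 64"
  have d: "0 < d" using \<epsilon> by (simp add: d_def)
  have x: "norm x = 1" "norm f = 1" "f x = 1" using state by (auto simp: state_pairs_def)
  have T: "norm T \<le> 1" using norm_le_numerical_radius[OF assms, of T] radius by simp
  obtain T0 and x0 :: "'k \<Rightarrow>\<^sub>C real" where T0: "norm T0 \<le> 1" "norm (T - T0) \<le> 2 * (\<epsilon> / 4)"
    and x0: "norm x0 \<le> 1" "norm (x - x0) \<le> \<epsilon> / 4"
    and xx0: "\<And>t. \<bar>1 - x t * x0 t\<bar> \<le> 1 - x t * x t"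
    and T0x0: "\<And>t. 1 - 2 * d < x t * T x t \<Longrightarrow> T0 x0 t = x0 t"
    using operator_perturbation[OF assms T, of x "\<epsilon> / 4"] x \<epsilon> unfolding d_def by auto
  have r1: "(x * T x) t \<le> 1" for t
  proof -
    have "\<bar>x t\<bar> * \<bar>T x t\<bar> \<le> 1 * 1"
      using abs_bcontfun_le_norm[of x t] abs_blinfun_bcontfun_le[of x 1 T t] x T
      by (intro mult_mono) auto
    then show ?thesis by (simp flip: abs_mult)
  qed
  \<comment> \<open>Since \<open>f\<close> vanishes on multiples of \<open>1 - x * x\<close>, it
    takes the same value at \<open>x * (x * T x)\<close> as at \<open>T x\<close>.\<close>
  have fr: "1 - d * (\<epsilon> / 4) \<le> f (x * (x * T x))"
  proof -
    have "f ((1 - x * x) * T x) = 0"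
      using abs_functional_defect_le[of f x "T x"] x by simp
    then show ?thesis using fTx by (simp add: left_diff_distrib blinfun.diff_right mult.assoc d_def)
  qed
  have "d * (\<epsilon> / 4) < d" using d \<epsilon> by simp
  then obtain f0 :: "('k \<Rightarrow>\<^sub>C real) \<Rightarrow>\<^sub>L real" where f0: "norm f0 \<le> 1" "norm (f - f0) \<le> 2 * (d * (\<epsilon> / 4)) / d"
    and f0_cong: "\<And>u v. (\<And>t. 1 - 2 * d < (x * T x) t \<Longrightarrow> apply_bcontfun u t = apply_bcontfun v t) \<Longrightarrow> f0 u = f0 v"
    and f0_one: "\<And>u. (\<And>t. \<bar>1 - x t * apply_bcontfun u t\<bar> \<le> 1 - x t * x t) \<Longrightarrow> f0 u = 1"
    using functional_perturbation[OF assms state r1 fr d] by blast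
  have f0x0: "f0 x0 = 1" by (rule f0_one) (rule xx0)
  have "1 \<le> norm f0 * norm x0" using norm_blinfun[of f0 x0] f0x0 by simp
  then have "norm x0 = 1" "norm f0 = 1"
    using x0(1) f0(1) mult_left_le[of "norm x0" "norm f0"] mult_left_le_one_le[of "norm x0" "norm f0"]
    by auto
  then have state0: "(x0, f0) \<in> state_pairs" using f0x0 by (simp add: state_pairs_def)
  \<comment> \<open>\<open>f0\<close> only sees the region where \<open>x * T x\<close> exceeds
    \<open>1 - 2 * d\<close>, and there \<open>T0 x0\<close> agrees with \<open>x0\<close>.\<close>
  have att: "f0 (T0 x0) = 1" using f0_cong[of "T0 x0" x0] T0x0 f0x0 by simp
  have "numerical_radius T0 = 1"
    using state_pair_le_numerical_radius[OF state0, of T0] numerical_radius_le_norm[OF state0, of T0]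
      att T0(1) by simp
  moreover have "numerical_radius (T - T0) \<le> \<epsilon>"
    using numerical_radius_le_norm[OF state0, of "T - T0"] T0(2) \<epsilon> by simp
  ultimately show "\<exists>T\<^sub>0 x\<^sub>0 f\<^sub>0. numerical_radius T\<^sub>0 = 1 \<and> (x\<^sub>0, f\<^sub>0) \<in> state_pairs \<and>
      blinfun_apply f\<^sub>0 (blinfun_apply T\<^sub>0 x\<^sub>0) = 1 \<and> numerical_radius (T - T\<^sub>0) \<le> \<epsilon> \<and>
      norm (x - x\<^sub>0) \<le> \<epsilon> \<and> norm (f - f\<^sub>0) \<le> \<epsilon>"
    using state0 att x0(2) f0(2) d \<epsilon> by (intro exI[of _ T0] exI[of _ x0] exI[of _ f0]) auto
qed

end
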